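(* Let $n\ge 2$ and let $m$ be an odd integer with $1\le m\le n-1$. Then there is no convex body $K\subset\mathbb R^n$ containing the origin in its interior that has a polynomial $m$th dual section function.
   Context: A convex body is a compact convex subset of $\mathbb R^n$ with non-empty interior. For a compact set $L\subset\mathbb R^n$ that is star-shaped about the origin (for every $x\in L$ the segment $[0,x]$ lies in $L$), its radial function is $\rho_L(\theta)=\max\{a\ge 0: a\theta\in L\}$, $\theta\in S^{n-1}$. Let $K$ be a convex body in $\mathbb R^n$ containing the origin in its interior, and let $m$ be an integer with $1\le m\le n-1$. For $\xi\in S^{n-1}$ let $\xi^\perp=\{x\in\mathbb R^n:\langle x,\xi\rangle=0\}$, and for $-\rho_K(-\xi)\le t\le\rho_K(\xi)$ (so that $t\xi\in K$ and $K-t\xi$ is star-shaped about the origin) define $$A_{K,m,\xi}(t)=\frac{1}{n-1}\int_{S^{n-1}\cap\xi^\perp}\rho_{K-t\xi}^m(\theta)\,d\theta,$$ where the integration is with respect to the (unnormalized) spherical Lebesgue measure on the $(n-2)$-dimensional unit sphere $S^{n-1}\cap\xi^\perp$ (counting measure if $n=2$). This is the $m$th dual volume of the section $K\cap\{\xi^\perp+t\xi\}$ taken within the hyperplane $\xi^\perp+t\xi$ with respect to the point $t\xi$. $K$ is said to have a polynomial $m$th dual section function if there are a positive integer $N$ (independent of $\xi$) and continuous functions $a_0,\dots,a_N$ on $S^{n-1}$ such that for every $\xi\in S^{n-1}$, $$A_{K,m,\xi}(t)=\sum_{k=0}^N a_k(\xi)\,t^k\quad\text{for all } -\rho_K(-\xi)\le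 t\le\rho_K(\xi).$$ *)

theory Defs
  imports "HOL-Analysis.Analysis"
begin

definition convex_body :: "'a::euclidean_space set \<Rightarrow> bool" where
  "convex_body K \<longleftrightarrow> compact K \<and> convex K \<and> interior K \<noteq> {}"

definition radial_function :: "'a::euclidean_space set \<Rightarrow> 'a \<Rightarrow> real" where
  "radial_function L \<theta> = (GREATEST a. 0 \<le> a \<and> a *\<^sub>R \<theta> \<in> L)"

definition orthonormal_basis_of :: "'a::euclidean_space set \<Rightarrow> 'a set \<Rightarrow> bool" where
  "orthonormal_basis_of V B \<longleftrightarrow>
     B \<subseteq> V \<and> pairwise orthogonal B \<and> (\<forall>b\<in>B. norm b = 1) \<and> span B = V"

lemma ex_orthonormal_basis_of:
  assumes "subspace V"
  shows "\<exists>B. orthonormal_basis_of V B"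
  using orthonormal_basis_subspace[OF assms] unfolding orthonormal_basis_of_def by metis

lemma orthonormal_basis_of_finite:
  assumes "orthonormal_basis_of V B"
  shows "finite B"
  using assms pairwise_orthogonal_imp_finite unfolding orthonormal_basis_of_def by blast

text \<open>
  Lebesgue measure on a linear subspace, in analogy with the definition of \<^const>\<open>lborel\<close>:
  the image of the product measure under the coordinates of an orthonormal basis. Lebesgue measure
  is invariant under linear isometries, so the choice of the basis does not matter.
\<close>

definition subspace_lborel :: "'a::euclidean_space set \<Rightarrow> 'a measure" where
  "subspace_lborel V =
     (let B = (SOME B. orthonormal_basis_of V B)
      in distr (\<Pi>\<^sub>M b\<in>B. lborel) (restrict_space borel V) (\<lambda>c. \<Sum>b\<in>B. c b *\<^sub>R b))"

text \<open>
  Unnormalized spherical Lebesgue measure on the unit sphere of a subspace \<open>V\<close> of dimension \<open>d\<close>: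
  the measure of \<open>A\<close> is \<open>d\<close> times the Lebesgue measure of the cone
  \<open>{r \<theta> | \<theta> \<in> A, 0 < r \<le> 1}\<close>, as in polar coordinates (see \<open>emeasure_spherical_measure\<close> below).
  For \<open>d = 1\<close> this is the counting measure on the two unit vectors.
\<close>

definition spherical_measure :: "'a::euclidean_space set \<Rightarrow> 'a measure" where
  "spherical_measure V =
     scale_measure (of_nat (dim V))
       (distr (restrict_space (subspace_lborel V) (cball 0 1 - {0}))
              (restrict_space borel (sphere 0 1 \<inter> V)) sgn)"

lemma sets_subspace_lborel [simp]: "sets (subspace_lborel V) = sets (restrict_space borel V)"
  and space_subspace_lborel [simp]: "space (subspace_lborel V) = V"
  by (simp_all add: subspace_lborel_def Let_def space_restrict_space)

lemma measurable_subspace_coords: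
  assumes "orthonormal_basis_of V B"
  shows "(\<lambda>c. \<Sum>b\<in>B. c b *\<^sub>R b) \<in> (\<Pi>\<^sub>M b\<in>B. lborel) \<rightarrow>\<^sub>M restrict_space borel V"
proof (rule measurable_restrict_space2)
  have "(\<Sum>b\<in>B. c b *\<^sub>R b) \<in> span B" for c :: "'a \<Rightarrow> real"
    by (intro span_sum span_scale span_base)
  then show "(\<lambda>c. \<Sum>b\<in>B. c b *\<^sub>R b) \<in> space (\<Pi>\<^sub>M b\<in>B. lborel) \<rightarrow> V"
    using assms by (auto simp: orthonormal_basis_of_def)
  show "(\<lambda>c. \<Sum>b\<in>B. c b *\<^sub>R b) \<in> (\<Pi>\<^sub>M b\<in>B. lborel) \<rightarrow>\<^sub>M borel"
    by measurable
qed

lemma measurable_sgn_sphere: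
  assumes "subspace V"
  shows "sgn \<in> restrict_space (subspace_lborel V) (cball 0 1 - {0})
               \<rightarrow>\<^sub>M restrict_space borel (sphere 0 1 \<inter> V)"
proof (rule measurable_restrict_space2)
  show "sgn \<in> space (restrict_space (subspace_lborel V) (cball 0 1 - {0})) \<rightarrow> sphere 0 1 \<inter> V"
    using assms by (auto simp: space_restrict_space norm_sgn sgn_div_norm subspace_scale)
  have "id \<in> subspace_lborel V \<rightarrow>\<^sub>M borel"
    by (subst measurable_cong_sets[OF sets_subspace_lborel refl]) (simp add: measurable_restrict_space1)
  then show "sgn \<in> restrict_space (subspace_lborel V) (cball 0 1 - {0}) \<rightarrow>\<^sub>M borel"
    unfolding sgn_div_norm by (intro measurable_restrict_space1) (auto simp: id_def)
qed

lemma emeasure_spherical_measure: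
  assumes V: "subspace V" and A: "A \<in> sets borel" "A \<subseteq> sphere 0 1 \<inter> V"
  shows "emeasure (spherical_measure V) A =
           of_nat (dim V) * emeasure (subspace_lborel V) {r *\<^sub>R \<theta> | r \<theta>. \<theta> \<in> A \<and> 0 < r \<and> r \<le> 1}"
proof -
  let ?R = "restrict_space (subspace_lborel V) (cball 0 1 - {0})"
  have eq: "sgn -` A \<inter> space ?R = {r *\<^sub>R \<theta> | r \<theta>. \<theta> \<in> A \<and> 0 < r \<and> r \<le> 1}" (is "?L = ?C")
  proof (intro equalityI subsetI)
    fix x assume "x \<in> ?L"
    then have "sgn x \<in> A" "0 < norm x" "norm x \<le> 1" "x = norm x *\<^sub>R sgn x"
      by (auto simp: space_restrict_space sgn_div_norm)
    then show "x \<in> ?C" by blast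
  next
    fix x assume "x \<in> ?C"
    then obtain r \<theta> where *: "x = r *\<^sub>R \<theta>" "\<theta> \<in> A" "0 < r" "r \<le> 1" by blast
    with A have "norm \<theta> = 1" "\<theta> \<in> V" by auto
    with * V show "x \<in> ?L"
      by (auto simp: space_restrict_space sgn_div_norm subspace_scale)
  qed
  have A': "A \<in> sets (restrict_space borel (sphere 0 1 \<inter> V))"
    using A by (auto simp: sets_restrict_space_iff sets_restrict_space)
  have W: "(cball 0 1 - {0}) \<inter> space (subspace_lborel V) \<in> sets (subspace_lborel V)"
    by (auto simp: sets_restrict_space Int_commute)
  show ?thesis
    unfolding spherical_measure_def
    by (simp add: emeasure_distr[OF measurable_sgn_sphere[OF V] A'] eq)
       (subst emeasure_restrict_space[OF W], use A V in \<open>auto simp: subspace_scale\<close>)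
qed

definition dual_section_function :: "'a::euclidean_space set \<Rightarrow> nat \<Rightarrow> 'a \<Rightarrow> real \<Rightarrow> real" where
  "dual_section_function K m \<xi> t =
     1 / (real DIM('a) - 1) *
     (\<integral>\<theta>. radial_function ((\<lambda>x. x - t *\<^sub>R \<xi>) ` K) \<theta> ^ m \<partial>spherical_measure {x. x \<bullet> \<xi> = 0})"

definition polynomial_dual_section_function :: "'a::euclidean_space set \<Rightarrow> nat \<Rightarrow> bool" where
  "polynomial_dual_section_function K m \<longleftrightarrow>
     (\<exists>N>0. \<exists>a :: nat \<Rightarrow> 'a \<Rightarrow> real.
        (\<forall>k\<le>N. continuous_on (sphere 0 1) (a k)) \<and>
        (\<forall>\<xi>\<in>sphere 0 1. \<forall>t\<in>{- radial_function K (- \<xi>)..radial_function K \<xi>}.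
           dual_section_function K m \<xi> t = (\<Sum>k\<le>N. a k \<xi> * t ^ k)))"

end

theory Submission
  imports Defs
begin

text \<open>
  Average the dual section functions over all directions \<open>\<xi>\<close>. The pairs \<open>(\<xi>, \<theta>)\<close> of orthogonal unit vectors
  are averaged in a rotation invariant way, so the average only depends on the distribution of the
  radial function, and comparison with balls shows that for small \<open>t\<close> it is a constant times
  the integral of \<open>(\<rho>\<^sub>K(\<theta>)\<^sup>2 - t\<^sup>2)\<^sup>m\<^sup>/\<^sup>2\<close> over the sphere. It would be a polynomial in \<open>t\<close>, but for odd \<open>m\<close>
  every Taylor coefficient of even order at \<open>t = 0\<close> is non-zero: it is a non-zero binomial factor
  times the integral of a power of \<open>\<rho>\<^sub>K\<close>. Instead of the sphere we use the unit ball, \<open>u\<close> standing for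
  the direction \<open>sgn u\<close>, and instead of values at \<open>t\<close> integrals over \<open>{0..T}\<close>, which are volume integrals.
\<close>

section \<open>Lebesgue measure in the coordinates of a basis\<close>

text \<open>The averaged kernel is never computed. Tonelli turns the average of the left-hand sides
  into an integral over \<open>K\<close> of a function of \<open>x\<close>; rotation invariance
  makes it a function of \<open>norm x\<close>, so \<open>K\<close> enters only through the
  integrals of that function over balls of radius \<open>radial_function K (sgn u)\<close>. These
  are known, because a section of a centred ball is again a ball about its own centre. Hence the
  measure theory below: rotation invariance of Lebesgue measure, and the fact that the hyperplane
  measures slice it whichever basis was chosen. Working in \<open>ennreal\<close> postpones all
  questions of integrability to the very end. The contradiction needs a single Taylor coefficient of
  high order. If \<open>M\<close> is large compared with the degree \<open>N\<close>, the assumed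
  polynomial minus the Taylor part below order \<open>M\<close> has degree at most 2 M in
  \<open>T\<close>, yet it is of exact order T^(2 M + 1) as \<open>T\<close> tends to 0. The
  estimate survives averaging because its constants do not depend on the radius and the radial
  function of \<open>K\<close> is bounded away from 0 and infinity.\<close>

definition basis_lborel :: "'a::euclidean_space set \<Rightarrow> 'a measure" where
  "basis_lborel B = distr (\<Pi>\<^sub>M b\<in>B. lborel) borel (\<lambda>c. \<Sum>b\<in>B. c b *\<^sub>R b)"

lemma sets_basis_lborel [simp, measurable_cong]: "sets (basis_lborel B) = sets borel"
  and space_basis_lborel [simp]: "space (basis_lborel B) = UNIV"
  by (simp_all add: basis_lborel_def)

lemma nn_integral_basis_lborel:
  fixes B :: "'a::euclidean_space set"
  assumes [measurable]: "f \<in> borel_measurable borel"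
  shows "(\<integral>\<^sup>+x. f x \<partial>basis_lborel B) = (\<integral>\<^sup>+c. f (\<Sum>b\<in>B. c b *\<^sub>R b) \<partial>(\<Pi>\<^sub>M b\<in>B. lborel))"
  unfolding basis_lborel_def by (rule nn_integral_distr) measurable

text \<open>The image measure need not be sigma-finite for an arbitrary finite \<open>B\<close>, so
  measurability in the parameter is derived in coordinates, where the product measure is
  sigma-finite.\<close>

lemma borel_measurable_nn_integral_basis_lborel:
  fixes B :: "'a::euclidean_space set" and g :: "'b::topological_space \<Rightarrow> 'a \<Rightarrow> ennreal"
  assumes "finite B" and [measurable]: "(\<lambda>(t, y). g t y) \<in> borel_measurable (borel \<Otimes>\<^sub>M borel)"
  shows "(\<lambda>t. \<integral>\<^sup>+y. g t y \<partial>basis_lborel B) \<in> borel_measurable borel"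
proof -
  interpret product_sigma_finite "\<lambda>_::'a. lborel :: real measure" ..
  interpret finite_product_sigma_finite "\<lambda>_::'a. lborel :: real measure" B
    by standard (rule assms(1))
  have "(\<integral>\<^sup>+y. g t y \<partial>basis_lborel B) = (\<integral>\<^sup>+c. g t (\<Sum>b\<in>B. c b *\<^sub>R b) \<partial>(\<Pi>\<^sub>M b\<in>B. lborel))" for t
    by (rule nn_integral_basis_lborel) measurable
  then show ?thesis by simp
qed

text \<open>Tonelli for one coordinate. This is the induction step for images and dilations, and
  with a unit normal as \<open>b\<close> it becomes the slicing by hyperplanes.\<close>

lemma nn_integral_basis_lborel_insert:
  fixes B :: "'a::euclidean_space set"
  assumes B: "finite B" "b \<notin> B" and [measurable]: "f \<in> borel_measurable borel"
  shows "(\<integral>\<^sup>+x. f x \<partial>basis_lborel (insert b B)) =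
         (\<integral>\<^sup>+t. (\<integral>\<^sup>+y. f (t *\<^sub>R b + y) \<partial>basis_lborel B) \<partial>lborel)"
proof -
  interpret product_sigma_finite "\<lambda>_::'a. lborel :: real measure" ..
  have "(\<integral>\<^sup>+x. f x \<partial>basis_lborel (insert b B)) =
      (\<integral>\<^sup>+c. f (\<Sum>a\<in>insert b B. c a *\<^sub>R a) \<partial>(\<Pi>\<^sub>M b\<in>insert b B. lborel))"
    by (rule nn_integral_basis_lborel) measurable
  also have "\<dots> = (\<integral>\<^sup>+t. (\<integral>\<^sup>+c. f (\<Sum>a\<in>insert b B. (c(b := t)) a *\<^sub>R a) \<partial>(\<Pi>\<^sub>M b\<in>B. lborel)) \<partial>lborel)"
    using B by (subst product_nn_integral_insert_rev) auto
  also have "(\<lambda>t c. \<Sum>a\<in>insert b B. (c(b := t)) a *\<^sub>R a) = (\<lambda>t c. t *\<^sub>R b + (\<Sum>a\<in>B. c a *\<^sub>R a))"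
    using B by (intro ext) (auto intro!: sum.cong)
  finally show ?thesis
    by (simp add: nn_integral_basis_lborel)
qed

text \<open>The coordinates stay the same and only the frame moves; injectivity on \<open>B\<close>
  keeps the number of coordinates.\<close>

lemma nn_integral_basis_lborel_image:
  fixes B :: "'a::euclidean_space set"
  assumes "finite B" "linear T" "inj_on T B" and f: "f \<in> borel_measurable borel"
  shows "(\<integral>\<^sup>+x. f x \<partial>basis_lborel (T ` B)) = (\<integral>\<^sup>+x. f (T x) \<partial>basis_lborel B)"
  using assms(1,3) f
proof (induction B arbitrary: f rule: finite_induct)
  case empty
  note empty.prems(2)[measurable]
  have [measurable]: "T \<in> borel_measurable borel"
    using assms(2) by (simp add: borel_measurable_continuous_onI linear_continuous_on linear_conv_bounded_linear)
  have T: "T 0 = 0" using assms(2) by (rule linear_0)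
  show ?case
    by (simp add: nn_integral_basis_lborel T PiM_empty nn_integral_count_space_finite)
next
  case (insert b B)
  note insert.prems(2)[measurable]
  have [measurable]: "T \<in> borel_measurable borel"
    using assms(2) by (simp add: borel_measurable_continuous_onI linear_continuous_on linear_conv_bounded_linear)
  have "(\<integral>\<^sup>+x. f x \<partial>basis_lborel (T ` insert b B)) =
      (\<integral>\<^sup>+t. (\<integral>\<^sup>+y. f (t *\<^sub>R T b + y) \<partial>basis_lborel (T ` B)) \<partial>lborel)"
    using insert by (simp add: nn_integral_basis_lborel_insert)
  also have "\<dots> = (\<integral>\<^sup>+t. (\<integral>\<^sup>+y. f (t *\<^sub>R T b + T y) \<partial>basis_lborel B) \<partial>lborel)"
    using insert by (intro nn_integral_cong) (simp add: inj_on_insert)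
  also have "\<dots> = (\<integral>\<^sup>+x. f (T x) \<partial>basis_lborel (insert b B))"
    using insert by (simp add: nn_integral_basis_lborel_insert linear_add[OF assms(2)] linear_scale[OF assms(2)])
  finally show ?case .
qed

text \<open>Each coordinate contributes one factor \<open>l\<close> through a one-dimensional
  substitution. This is the homogeneity on which polar coordinates rest.\<close>

lemma nn_integral_basis_lborel_scale:
  fixes B :: "'a::euclidean_space set" and l :: real
  assumes "finite B" "l > 0" and f: "f \<in> borel_measurable borel"
  shows "ennreal (l ^ card B) * (\<integral>\<^sup>+x. f (l *\<^sub>R x) \<partial>basis_lborel B) = (\<integral>\<^sup>+x. f x \<partial>basis_lborel B)"
  using assms(1) f
proof (induction B arbitrary: f rule: finite_induct)
  case empty
  note empty.prems(1)[measurable]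
  show ?case
    by (simp add: nn_integral_basis_lborel PiM_empty nn_integral_count_space_finite)
next
  case (insert b B)
  note insert.prems(1)[measurable]
  have [measurable]:
    "(\<lambda>t. \<integral>\<^sup>+y. f ((l * t) *\<^sub>R b + l *\<^sub>R y) \<partial>basis_lborel B) \<in> borel_measurable borel"
    "(\<lambda>t. \<integral>\<^sup>+y. f (t *\<^sub>R b + y) \<partial>basis_lborel B) \<in> borel_measurable borel"
    using insert by (auto intro!: borel_measurable_nn_integral_basis_lborel)
  have "ennreal (l ^ card (insert b B)) * (\<integral>\<^sup>+x. f (l *\<^sub>R x) \<partial>basis_lborel (insert b B)) =
      ennreal l * (ennreal (l ^ card B) * (\<integral>\<^sup>+t. (\<integral>\<^sup>+y. f (l *\<^sub>R (t *\<^sub>R b + y)) \<partial>basis_lborel B) \<partial>lborel))"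
    using insert assms(2) by (simp add: nn_integral_basis_lborel_insert ennreal_mult mult.assoc)
  also have "\<dots> = ennreal l * (\<integral>\<^sup>+t. ennreal (l ^ card B) * (\<integral>\<^sup>+y. f ((l * t) *\<^sub>R b + l *\<^sub>R y) \<partial>basis_lborel B) \<partial>lborel)"
    by (subst nn_integral_cmult) (simp_all add: scaleR_add_right)
  also have "\<dots> = ennreal l * (\<integral>\<^sup>+t. (\<integral>\<^sup>+y. f ((l * t) *\<^sub>R b + y) \<partial>basis_lborel B) \<partial>lborel)"
    by (intro arg_cong2[where f="(*)"] refl nn_integral_cong insert.IH) measurable
  also have "\<dots> = (\<integral>\<^sup>+t. (\<integral>\<^sup>+y. f (t *\<^sub>R b + y) \<partial>basis_lborel B) \<partial>lborel)"
    by (subst nn_integral_real_affine[where c=l and t=0 and f="\<lambda>t. \<integral>\<^sup>+y. f (t *\<^sub>R b + y) \<partial>basis_lborel B"])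
       (use assms(2) in simp_all)
  finally show ?case
    using insert by (simp add: nn_integral_basis_lborel_insert)
qed

lemma basis_lborel_Basis: "basis_lborel Basis = lborel"
  by (simp add: basis_lborel_def lborel_eq[symmetric])

section \<open>Rotation invariance of Lebesgue measure\<close>

lemma mult_right_cancel_ennreal:
  fixes a b c :: ennreal
  assumes "a * c = b * c" "c \<noteq> 0" "c \<noteq> top"
  shows "a = b"
  using assms mult_divide_eq_ennreal by metis

lemma emeasure_unit_cball:
  "emeasure lborel (cball (0::'a::euclidean_space) 1) \<noteq> 0"
  "emeasure lborel (cball (0::'a::euclidean_space) 1) \<noteq> top"
  by (simp_all add: emeasure_cball less_imp_neq[OF unit_ball_vol_pos, symmetric])

lemma nn_integral_lborel_translate:
  fixes f :: "'a::euclidean_space \<Rightarrow> ennreal"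
  assumes [measurable]: "f \<in> borel_measurable borel"
  shows "(\<integral>\<^sup>+x. f (x + a) \<partial>lborel) = (\<integral>\<^sup>+x. f x \<partial>lborel)"
  using nn_integral_distr[of "(+) a" lborel borel f] lborel_distr_plus[of a] by (simp add: add.commute)

text \<open>
  Uniqueness of a translation-invariant measure: the double integral of \<open>f (T x) * c (T x + y)\<close>, with \<open>c\<close>
  the indicator of the unit ball, is evaluated in both orders.
\<close>

lemma nn_integral_lborel_orthogonal:
  fixes T :: "'a::euclidean_space \<Rightarrow> 'a"
  assumes T: "orthogonal_transformation T" and [measurable]: "f \<in> borel_measurable borel"
  shows "(\<integral>\<^sup>+x. f (T x) \<partial>lborel) = (\<integral>\<^sup>+x. f x \<partial>lborel)"
proof -
  let ?c = "indicator (cball (0::'a) 1) :: 'a \<Rightarrow> ennreal"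
  let ?v = "emeasure lborel (cball (0::'a) 1)"
  have [measurable]: "cball (0::'a) 1 \<in> sets borel"
    by simp
  have lin: "linear T"
    using T by (rule orthogonal_transformation_linear)
  have [measurable]: "T \<in> borel_measurable borel"
    using lin by (simp add: borel_measurable_continuous_onI linear_continuous_on linear_conv_bounded_linear)
  have refl: "(\<integral>\<^sup>+y. f (a - y) \<partial>lborel) = (\<integral>\<^sup>+y. f y \<partial>lborel)" for a
  proof -
    have "lborel = distr lborel borel (\<lambda>x. a + (- 1) *\<^sub>R x)"
      using lborel_affine[of "- 1" a] by (simp add: density_1)
    then have "(\<integral>\<^sup>+y. f y \<partial>lborel) = (\<integral>\<^sup>+y. f y \<partial>distr lborel borel (\<lambda>x. a + (- 1) *\<^sub>R x))"
      by simp
    also have "\<dots> = (\<integral>\<^sup>+y. f (a - y) \<partial>lborel)"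
      by (subst nn_integral_distr) auto
    finally show ?thesis by simp
  qed
  have c: "(\<integral>\<^sup>+y. ?c (y + a) \<partial>lborel) = ?v" for a
    by (subst nn_integral_lborel_translate) simp_all
  have "(\<integral>\<^sup>+y. f (T x) * ?c (y + T x) \<partial>lborel) = f (T x) * ?v" for x
    by (subst nn_integral_cmult) (simp_all add: c)
  then have "(\<integral>\<^sup>+x. f (T x) \<partial>lborel) * ?v = (\<integral>\<^sup>+x. (\<integral>\<^sup>+y. f (T x) * ?c (y + T x) \<partial>lborel) \<partial>lborel)"
    by (simp add: nn_integral_multc)
  also have "\<dots> = (\<integral>\<^sup>+y. (\<integral>\<^sup>+x. f (T x) * ?c (y + T x) \<partial>lborel) \<partial>lborel)"
    by (rule lborel_pair.Fubini') measurable
  also have "\<dots> = (\<integral>\<^sup>+y. (\<integral>\<^sup>+x. f (T x - y) * ?c (T x) \<partial>lborel) \<partial>lborel)"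
  proof (rule nn_integral_cong)
    fix y
    obtain z where z: "T z = y"
      using orthogonal_transformation_surj[OF T] by (metis surjD)
    have "(\<integral>\<^sup>+x. f (T x) * ?c (y + T x) \<partial>lborel) = (\<integral>\<^sup>+x. f (T (x + - z)) * ?c (y + T (x + - z)) \<partial>lborel)"
      by (subst nn_integral_lborel_translate[where a="- z" and f="\<lambda>x. f (T x) * ?c (y + T x)"]) simp_all
    then show "(\<integral>\<^sup>+x. f (T x) * ?c (y + T x) \<partial>lborel) = (\<integral>\<^sup>+x. f (T x - y) * ?c (T x) \<partial>lborel)"
      by (simp add: linear_diff[OF lin] z)
  qed
  also have "\<dots> = (\<integral>\<^sup>+x. (\<integral>\<^sup>+y. f (T x - y) * ?c (T x) \<partial>lborel) \<partial>lborel)"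
    by (rule lborel_pair.Fubini') measurable
  also have "\<dots> = (\<integral>\<^sup>+x. (\<integral>\<^sup>+y. f y \<partial>lborel) * ?c x \<partial>lborel)"
  proof (rule nn_integral_cong)
    fix x
    have "?c (T x) = ?c x"
      using T by (simp add: orthogonal_transformation_norm indicator_def)
    then show "(\<integral>\<^sup>+y. f (T x - y) * ?c (T x) \<partial>lborel) = (\<integral>\<^sup>+y. f y \<partial>lborel) * ?c x"
      by (simp add: refl nn_integral_multc)
  qed
  also have "\<dots> = (\<integral>\<^sup>+x. f x \<partial>lborel) * ?v"
    by (simp add: nn_integral_cmult borel_closed)
  finally show ?thesis
    using mult_right_cancel_ennreal emeasure_unit_cball by blast
qed

text \<open>A bijection from \<open>Basis\<close> to \<open>B\<close> extends linearly to an
  isometry, and isometries preserve \<open>lborel\<close>. This makes the arbitrary choice of basis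
  in \<open>subspace_lborel\<close> harmless.\<close>

lemma basis_lborel_orthonormal:
  fixes B :: "'a::euclidean_space set"
  assumes "orthonormal_basis_of UNIV B"
  shows "basis_lborel B = lborel"
proof -
  have B: "pairwise orthogonal B" "\<And>b. b \<in> B \<Longrightarrow> norm b = 1" "span B = UNIV"
    using assms by (auto simp: orthonormal_basis_of_def)
  have fin: "finite B"
    by (rule orthonormal_basis_of_finite[OF assms])
  have ind: "independent B"
    using B by (intro pairwise_orthogonal_independent) (auto dest: B(2))
  have "card B = card (Basis :: 'a set)"
    using basis_card_eq_dim[of B UNIV] B ind by simp
  then obtain s where s: "bij_betw s (Basis :: 'a set) B"
    using fin by (metis finite_Basis finite_same_card_bij)
  define T where "T x = (\<Sum>b\<in>Basis. (x \<bullet> b) *\<^sub>R s b)" for x :: "'a"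
  have lin: "linear T"
    unfolding T_def by (intro linearI) (auto simp: inner_add_left scaleR_add_left sum.distrib scaleR_sum_right)
  have Ts: "T b = s b" if "b \<in> Basis" for b
  proof -
    have "T b = (\<Sum>a\<in>Basis. if a = b then s b else 0)"
      unfolding T_def using that by (intro sum.cong) (auto simp: inner_Basis)
    then show ?thesis using that by simp
  qed
  have ss: "s a \<bullet> s b = (if a = b then 1 else 0)" if "a \<in> Basis" "b \<in> Basis" for a b
  proof -
    have "s a \<in> B" "s b \<in> B" "s a = s b \<longleftrightarrow> a = b"
      using s that by (auto simp: bij_betw_def inj_on_eq_iff)
    then show ?thesis
      using B by (auto simp: pairwise_def orthogonal_def norm_eq_1)
  qed
  have "T x \<bullet> T y = x \<bullet> y" for x y
  proof -
    have "T x \<bullet> T y = (\<Sum>b\<in>Basis. \<Sum>a\<in>Basis. (y \<bullet> b) * ((x \<bullet> a) * (s a \<bullet> s b)))"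
      unfolding T_def by (simp add: inner_sum_left inner_sum_right sum_distrib_left)
    also have "\<dots> = (\<Sum>b\<in>Basis. \<Sum>a\<in>Basis. if a = b then (x \<bullet> b) * (y \<bullet> b) else 0)"
      by (intro sum.cong refl) (auto simp: ss)
    also have "\<dots> = x \<bullet> y"
      by (simp add: euclidean_inner[of x y])
    finally show ?thesis .
  qed
  with lin have T: "orthogonal_transformation T"
    by (simp add: orthogonal_transformation_def)
  have im: "T ` Basis = B"
    using s Ts by (auto simp: bij_betw_def image_iff)
  have inj: "inj_on T Basis"
    using orthogonal_transformation_inj[OF T] by (rule inj_on_subset) simp
  show ?thesis
  proof (rule measure_eqI)
    fix A assume "A \<in> sets (basis_lborel B)"
    then have A: "A \<in> sets borel" by simp
    have "emeasure (basis_lborel B) A = (\<integral>\<^sup>+x. indicator A x \<partial>basis_lborel (T ` Basis))"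
      using A by (simp add: im)
    also have "\<dots> = (\<integral>\<^sup>+x. indicator A (T x) \<partial>lborel)"
      using A by (subst nn_integral_basis_lborel_image) (simp_all add: lin inj basis_lborel_Basis)
    also have "\<dots> = (\<integral>\<^sup>+x. indicator A x \<partial>lborel)"
      using A by (intro nn_integral_lborel_orthogonal T) simp
    finally show "emeasure (basis_lborel B) A = emeasure lborel A"
      using A by simp
  qed simp
qed

section \<open>Polar coordinates\<close>

lemma borel_cball [measurable]: "cball (a::'a::euclidean_space) r \<in> sets borel"
  by simp

text \<open>The integrand is the Pareto density with threshold \<open>a\<close> and exponent
  \<open>d\<close>. That its mass is 1 for every \<open>a\<close> is what makes the auxiliary
  variable \<open>l\<close> disappear in the polar coordinate formula.\<close>

lemma nn_integral_inverse_power: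
  fixes a :: real
  assumes "a > 0" "d > 0"
  shows "(\<integral>\<^sup>+l. ennreal (real d * a ^ d / l ^ Suc d) * indicator {a..} l \<partial>lborel) = 1"
proof -
  have "(\<integral>\<^sup>+l. ennreal (real d * a ^ d / l ^ Suc d) * indicator {a..} l \<partial>lborel) = ennreal (0 - (- ((a / a) ^ d)))"
  proof (rule nn_integral_FTC_atLeast[where F="\<lambda>l. - ((a / l) ^ d)"])
    fix l assume l: "a \<le> l"
    then have "l > 0" using assms by simp
    obtain e where e: "d = Suc e" using assms(2) by (cases d) auto
    have "((\<lambda>l. l ^ d) has_real_derivative real d * l ^ (d - 1)) (at l)"
      using DERIV_pow[of d l] by simp
    from DERIV_cmult[OF DERIV_inverse_fun[OF this], of "- (a ^ d)"]
    have "((\<lambda>l. - (a ^ d) * inverse (l ^ d)) has_real_derivative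
        - (a ^ d) * - (inverse (l ^ d) * (real d * l ^ (d - 1)) * inverse (l ^ d))) (at l)"
      using \<open>l > 0\<close> by (simp add: mult_ac)
    also have "- (a ^ d) * - (inverse (l ^ d) * (real d * l ^ (d - 1)) * inverse (l ^ d)) = real d * a ^ d / l ^ Suc d"
      using \<open>l > 0\<close> unfolding e by (simp add: field_simps del: of_nat_Suc)
    also have "(\<lambda>l. - (a ^ d) * inverse (l ^ d)) = (\<lambda>l. - ((a / l) ^ d))"
      by (simp add: power_mult_distrib power_inverse divide_inverse)
    finally show "((\<lambda>l. - ((a / l) ^ d)) has_real_derivative real d * a ^ d / l ^ Suc d) (at l)" .
    show "0 \<le> real d * a ^ d / l ^ Suc d"
      using \<open>l > 0\<close> assms by simp
  next
    have "((\<lambda>l. a / l) \<longlongrightarrow> 0) at_top"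
      by (rule tendsto_divide_0[OF tendsto_const filterlim_at_top_imp_at_infinity[OF filterlim_ident]])
    then have "((\<lambda>l. - ((a / l) ^ d)) \<longlongrightarrow> - (0 ^ d)) at_top"
      by (intro tendsto_intros)
    then show "((\<lambda>l. - ((a / l) ^ d)) \<longlongrightarrow> 0) at_top"
      using assms by (simp add: power_0_left)
  qed measurable
  then show ?thesis using assms by simp
qed

text \<open>
  Substituting \<open>r = l * norm u\<close> in the radial integral and then \<open>x = l u\<close> in the integral over \<open>u\<close>
  reduces this to Tonelli and \<open>nn_integral_inverse_power\<close>. The hypothesis \<open>f 0 = 0\<close> stands in for
  \<open>{0}\<close> being a null set, since \<open>sgn 0 = 0\<close>.
\<close>

lemma nn_integral_polar:
  fixes M :: "'a::euclidean_space measure" and f :: "'a \<Rightarrow> ennreal" and d :: nat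
  assumes sets [measurable_cong, simp]: "sets M = sets borel" and d: "d > 0"
    and scale: "\<And>g l. g \<in> borel_measurable borel \<Longrightarrow> l > 0 \<Longrightarrow>
      ennreal (l ^ d) * (\<integral>\<^sup>+x. g (l *\<^sub>R x) \<partial>M) = (\<integral>\<^sup>+x. g x \<partial>M)"
    and fin: "emeasure M (cball 0 1) \<noteq> \<infinity>"
    and f [measurable]: "f \<in> borel_measurable borel" and f0: "f 0 = 0"
  shows "(\<integral>\<^sup>+x. f x \<partial>M) =
    (\<integral>\<^sup>+u. indicator (cball 0 1) u *
       (\<integral>\<^sup>+r. indicator {0<..} r * (ennreal (real d * r ^ (d - 1)) * f (r *\<^sub>R sgn u)) \<partial>lborel) \<partial>M)"
proof -
  have space [simp]: "space M = UNIV"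
    using sets_eq_imp_space_eq[OF sets] by simp
  \<comment> \<open>Dilation carries finiteness from the unit ball to all balls, which gives the
    sigma-finiteness required by Tonelli.\<close>
  have finl: "emeasure M (cball 0 l) \<noteq> \<infinity>" if "l > 0" for l
  proof -
    have "emeasure M (cball 0 l) = (\<integral>\<^sup>+x. indicator (cball 0 l) x \<partial>M)"
      by simp
    also have "\<dots> = ennreal (l ^ d) * (\<integral>\<^sup>+x. indicator (cball 0 l) (l *\<^sub>R x) \<partial>M)"
      using that by (intro scale[symmetric]) simp_all
    also have "(\<lambda>x::'a. indicator (cball 0 l) (l *\<^sub>R x) :: ennreal) = indicator (cball 0 1)"
      using that by (auto simp: indicator_def fun_eq_iff)
    finally show ?thesis
      using fin by (simp add: ennreal_mult_eq_top_iff)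
  qed
  interpret sigma_finite_measure M
  proof
    have "\<exists>n. x \<in> cball 0 (real (Suc n))" for x :: 'a
      using real_arch_simple[of "norm x"] by (fastforce intro: add_increasing)
    then have "\<Union> (range (\<lambda>n. cball (0::'a) (real (Suc n)))) = UNIV"
      by blast
    then show "\<exists>A. countable A \<and> A \<subseteq> sets M \<and> \<Union> A = space M \<and> (\<forall>a\<in>A. emeasure M a \<noteq> \<infinity>)"
      using finl by (intro exI[of _ "range (\<lambda>n. cball (0::'a) (real (Suc n)))"]) auto
  qed
  interpret pair_sigma_finite M "lborel :: real measure" ..
  \<comment> \<open>\<open>h\<close> is the double integrand after the radial substitution,
    \<open>k\<close> its form in the variable x = l u. The cutoff norm u <= 1 turns into norm x <=
    l, so for fixed x the variable l runs over a half-line.\<close>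
  define h where "h l u = indicator {0<..} l * indicator (cball 0 1) u * ennreal (real d * norm u ^ d * l ^ (d - 1)) * f (l *\<^sub>R u)"
    for l :: real and u :: 'a
  define k where "k l x = ennreal (real d * norm x ^ d / l ^ Suc d) * indicator {norm x..} l * (indicator {0<..} l * f x)"
    for l :: real and x :: 'a
  have [measurable]: "case_prod h \<in> borel_measurable (borel \<Otimes>\<^sub>M borel)"
    "(\<lambda>p. h (snd p) (fst p)) \<in> borel_measurable (borel \<Otimes>\<^sub>M borel)"
    unfolding h_def by measurable
  have [measurable]: "case_prod k \<in> borel_measurable (borel \<Otimes>\<^sub>M borel)"
    "(\<lambda>p. k (snd p) (fst p)) \<in> borel_measurable (borel \<Otimes>\<^sub>M borel)"
    unfolding k_def indicator_def atLeast_iff by measurable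
  have 1: "indicator (cball 0 1) u *
       (\<integral>\<^sup>+r. indicator {0<..} r * (ennreal (real d * r ^ (d - 1)) * f (r *\<^sub>R sgn u)) \<partial>lborel) = (\<integral>\<^sup>+l. h l u \<partial>lborel)" for u
  proof (cases "u = 0")
    case True
    then show ?thesis by (simp add: h_def f0)
  next
    case False
    then have n: "norm u > 0" by simp
    have dd: "norm u * norm u ^ (d - 1) = norm u ^ d"
      using d by (cases d) auto
    have "(\<integral>\<^sup>+r. indicator {0<..} r * (ennreal (real d * r ^ (d - 1)) * f (r *\<^sub>R sgn u)) \<partial>lborel) =
        ennreal \<bar>norm u\<bar> * (\<integral>\<^sup>+l. indicator {0<..} (0 + norm u * l) * (ennreal (real d * (0 + norm u * l) ^ (d - 1)) * f ((0 + norm u * l) *\<^sub>R sgn u)) \<partial>lborel)"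
      using n by (subst nn_integral_real_affine[where c="norm u" and t=0]) simp_all
    also have "\<dots> = (\<integral>\<^sup>+l. ennreal (norm u) * (indicator {0<..} (norm u * l) * (ennreal (real d * (norm u * l) ^ (d - 1)) * f ((norm u * l) *\<^sub>R sgn u))) \<partial>lborel)"
      by (subst nn_integral_cmult) simp_all
    finally have "indicator (cball 0 1) u *
       (\<integral>\<^sup>+r. indicator {0<..} r * (ennreal (real d * r ^ (d - 1)) * f (r *\<^sub>R sgn u)) \<partial>lborel) =
       (\<integral>\<^sup>+l. indicator (cball 0 1) u * (ennreal (norm u) * (indicator {0<..} (norm u * l) * (ennreal (real d * (norm u * l) ^ (d - 1)) * f ((norm u * l) *\<^sub>R sgn u)))) \<partial>lborel)"
      by (simp add: nn_integral_cmult)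
    also have "\<dots> = (\<integral>\<^sup>+l. h l u \<partial>lborel)"
    proof (rule nn_integral_cong)
      fix l :: real
      have s: "(norm u * l) *\<^sub>R sgn u = l *\<^sub>R u"
        using n by (simp add: sgn_div_norm)
      show "indicator (cball 0 1) u * (ennreal (norm u) * (indicator {0<..} (norm u * l) * (ennreal (real d * (norm u * l) ^ (d - 1)) * f ((norm u * l) *\<^sub>R sgn u)))) = h l u"
      proof (cases "l > 0")
        case True
        have "ennreal (norm u) * ennreal (real d * (norm u * l) ^ (d - 1)) = ennreal (real d * norm u ^ d * l ^ (d - 1))"
          using True by (simp add: ennreal_mult[symmetric] power_mult_distrib dd[symmetric] mult_ac)
        with True n show ?thesis
          unfolding h_def s by (simp add: mult.assoc[symmetric])
      next
        case False
        with n show ?thesis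
          by (simp add: h_def zero_less_mult_iff)
      qed
    qed
    finally show ?thesis .
  qed
  have 2: "(\<integral>\<^sup>+u. h l u \<partial>M) = (\<integral>\<^sup>+x. k l x \<partial>M)" for l
  proof (cases "l > 0")
    case True
    have [measurable]: "(\<lambda>x. k l x) \<in> borel_measurable borel"
      unfolding k_def indicator_def atLeast_iff by measurable
    have "(\<integral>\<^sup>+x. k l x \<partial>M) = ennreal (l ^ d) * (\<integral>\<^sup>+u. k l (l *\<^sub>R u) \<partial>M)"
      using True by (intro scale[symmetric]) simp_all
    also have "\<dots> = (\<integral>\<^sup>+u. ennreal (l ^ d) * k l (l *\<^sub>R u) \<partial>M)"
      by (subst nn_integral_cmult) simp_all
    also have "\<dots> = (\<integral>\<^sup>+u. h l u \<partial>M)"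
    proof (rule nn_integral_cong)
      fix u :: 'a
      have "l ^ d * (real d * norm (l *\<^sub>R u) ^ d / l ^ Suc d) = real d * norm u ^ d * l ^ (d - 1)"
        using True d by (cases d) (simp_all add: field_simps)
      then have e: "ennreal (l ^ d) * ennreal (real d * norm (l *\<^sub>R u) ^ d / l ^ Suc d) = ennreal (real d * norm u ^ d * l ^ (d - 1))"
        using True by (subst ennreal_mult[symmetric]) simp_all
      have i: "indicator {norm (l *\<^sub>R u)..} l = (indicator (cball 0 1) u :: ennreal)"
        using True by (simp add: indicator_def)
      show "ennreal (l ^ d) * k l (l *\<^sub>R u) = h l u"
        unfolding k_def h_def mult.assoc[symmetric] e i by (simp only: mult_ac)
    qed
    finally show ?thesis by simp
  next
    case False
    then show ?thesis by (simp add: h_def k_def)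
  qed
  have 3: "(\<integral>\<^sup>+l. k l x \<partial>lborel) = f x" for x
  proof (cases "x = 0")
    case True
    then show ?thesis by (simp add: k_def f0)
  next
    case False
    have "(\<integral>\<^sup>+l. k l x \<partial>lborel) = (\<integral>\<^sup>+l. ennreal (real d * norm x ^ d / l ^ Suc d) * indicator {norm x..} l * f x \<partial>lborel)"
    proof (rule nn_integral_cong)
      fix l :: real
      have "l > 0" if "norm x \<le> l"
        using False that by (meson less_le_trans zero_less_norm_iff)
      then show "k l x = ennreal (real d * norm x ^ d / l ^ Suc d) * indicator {norm x..} l * f x"
        by (simp add: k_def indicator_def)
    qed
    also have "\<dots> = f x"
      using False d by (simp add: nn_integral_multc nn_integral_inverse_power del: power_Suc)
    finally show ?thesis .
  qed
  have "(\<integral>\<^sup>+u. indicator (cball 0 1) u *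
       (\<integral>\<^sup>+r. indicator {0<..} r * (ennreal (real d * r ^ (d - 1)) * f (r *\<^sub>R sgn u)) \<partial>lborel) \<partial>M) =
       (\<integral>\<^sup>+u. \<integral>\<^sup>+l. h l u \<partial>lborel \<partial>M)"
    by (simp only: 1)
  also have "\<dots> = (\<integral>\<^sup>+l. \<integral>\<^sup>+u. h l u \<partial>M \<partial>lborel)"
    by (rule Fubini'[symmetric]) measurable
  also have "\<dots> = (\<integral>\<^sup>+l. \<integral>\<^sup>+x. k l x \<partial>M \<partial>lborel)"
    by (simp add: 2)
  also have "\<dots> = (\<integral>\<^sup>+x. \<integral>\<^sup>+l. k l x \<partial>lborel \<partial>M)"
    by (rule Fubini') measurable
  also have "\<dots> = (\<integral>\<^sup>+x. f x \<partial>M)"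
    by (simp add: 3)
  finally show ?thesis by simp
qed

section \<open>Hyperplanes through the origin\<close>

text \<open>The measure is defined on the Borel sets of the whole space but is the image of
  coordinates that only reach the span, so integrands may be changed off the span.\<close>

lemma nn_integral_basis_lborel_cong_span:
  fixes f g :: "'a::euclidean_space \<Rightarrow> ennreal"
  assumes "f \<in> borel_measurable borel" "g \<in> borel_measurable borel" "\<And>y. y \<in> span B \<Longrightarrow> f y = g y"
  shows "(\<integral>\<^sup>+y. f y \<partial>basis_lborel B) = (\<integral>\<^sup>+y. g y \<partial>basis_lborel B)"
  using assms by (simp add: nn_integral_basis_lborel span_sum span_scale span_base)

lemma norm_slice:
  fixes y :: "'a::euclidean_space"
  assumes "norm \<xi> = 1" "y \<bullet> \<xi> = 0"
  shows "(norm (t *\<^sub>R \<xi> + y))\<^sup>2 = t\<^sup>2 + (norm y)\<^sup>2"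
  using norm_add_Pythagorean[of "t *\<^sub>R \<xi>" y] assms by (simp add: orthogonal_def inner_commute)

definition perp :: "'a::euclidean_space \<Rightarrow> 'a set" where
  "perp \<xi> = {x. x \<bullet> \<xi> = 0}"

text \<open>This is literally the choice term inside \<open>subspace_lborel\<close>, so the
  hyperplane measure of the problem unfolds to this very basis.\<close>

definition perp_basis :: "'a::euclidean_space \<Rightarrow> 'a set" where
  "perp_basis \<xi> = (SOME B. orthonormal_basis_of (perp \<xi>) B)"

definition perp_lborel :: "'a::euclidean_space \<Rightarrow> 'a measure" where
  "perp_lborel \<xi> = basis_lborel (perp_basis \<xi>)"

lemma sets_perp_lborel [simp, measurable_cong]: "sets (perp_lborel \<xi>) = sets borel"
  and space_perp_lborel [simp]: "space (perp_lborel \<xi>) = UNIV"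
  by (simp_all add: perp_lborel_def)

lemma subspace_perp: "subspace (perp \<xi>)"
  unfolding perp_def by (simp add: subspace_hyperplane2)

lemma perp_basis: "orthonormal_basis_of (perp \<xi>) (perp_basis \<xi>)"
  unfolding perp_basis_def using ex_orthonormal_basis_of[OF subspace_perp] by (rule someI_ex)

lemma span_perp_basis: "span (perp_basis \<xi>) = perp \<xi>"
  using perp_basis by (auto simp: orthonormal_basis_of_def)

lemma finite_perp_basis: "finite (perp_basis \<xi>)"
  using perp_basis by (rule orthonormal_basis_of_finite)

lemma dim_perp:
  assumes "norm (\<xi>::'a::euclidean_space) = 1"
  shows "dim (perp \<xi>) = DIM('a) - 1"
proof -
  have "\<xi> \<noteq> 0" using assms by auto
  then show ?thesis
    unfolding perp_def using dim_hyperplane[of \<xi>] by (simp add: inner_commute)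
qed

lemma card_perp_basis:
  assumes "norm (\<xi>::'a::euclidean_space) = 1"
  shows "card (perp_basis \<xi>) = DIM('a) - 1"
proof -
  have B: "pairwise orthogonal (perp_basis \<xi>)" "\<And>b. b \<in> perp_basis \<xi> \<Longrightarrow> norm b = 1"
    using perp_basis by (auto simp: orthonormal_basis_of_def)
  have "independent (perp_basis \<xi>)"
    using B by (intro pairwise_orthogonal_independent) (auto dest: B(2))
  then have "card (perp_basis \<xi>) = dim (perp \<xi>)"
    by (metis dim_span_eq_card_independent span_perp_basis)
  then show ?thesis using dim_perp[OF assms] by simp
qed

text \<open>Adding the unit normal to the basis of the hyperplane gives an orthonormal basis of the
  whole space; its measure is \<open>lborel\<close>, and the normal coordinate is split off.\<close>

lemma nn_integral_lborel_slice:
  fixes f :: "'a::euclidean_space \<Rightarrow> ennreal"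
  assumes \<xi>: "norm \<xi> = 1" and f: "f \<in> borel_measurable borel"
  shows "(\<integral>\<^sup>+x. f x \<partial>lborel) = (\<integral>\<^sup>+t. (\<integral>\<^sup>+y. f (t *\<^sub>R \<xi> + y) \<partial>perp_lborel \<xi>) \<partial>lborel)"
proof -
  have B: "pairwise orthogonal (perp_basis \<xi>)" "\<And>b. b \<in> perp_basis \<xi> \<Longrightarrow> norm b = 1"
      "\<And>b. b \<in> perp_basis \<xi> \<Longrightarrow> b \<bullet> \<xi> = 0"
    using perp_basis[of \<xi>] by (auto simp: orthonormal_basis_of_def perp_def)
  have n: "\<xi> \<notin> perp_basis \<xi>"
    using B(3)[of \<xi>] \<xi> by auto
  have "x \<in> span (insert \<xi> (perp_basis \<xi>))" for x
  proof -
    have "x - (x \<bullet> \<xi>) *\<^sub>R \<xi> \<in> span (perp_basis \<xi>)"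
      using \<xi> by (simp add: span_perp_basis perp_def inner_diff_left norm_eq_1)
    then show ?thesis
      by (auto simp: span_insert)
  qed
  moreover have "pairwise orthogonal (insert \<xi> (perp_basis \<xi>))"
    using B by (auto simp: pairwise_insert orthogonal_def inner_commute)
  ultimately have "orthonormal_basis_of UNIV (insert \<xi> (perp_basis \<xi>))"
    using B \<xi> by (auto simp: orthonormal_basis_of_def)
  then have "basis_lborel (insert \<xi> (perp_basis \<xi>)) = lborel"
    by (rule basis_lborel_orthonormal)
  with nn_integral_basis_lborel_insert[OF finite_perp_basis n f] show ?thesis
    by (simp add: perp_lborel_def)
qed

lemma perp_lborel_scale:
  fixes \<xi> :: "'a::euclidean_space"
  assumes "norm \<xi> = 1" "l > 0" "f \<in> borel_measurable borel"
  shows "ennreal (l ^ (DIM('a) - 1)) * (\<integral>\<^sup>+x. f (l *\<^sub>R x) \<partial>perp_lborel \<xi>) = (\<integral>\<^sup>+x. f x \<partial>perp_lborel \<xi>)"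
  using nn_integral_basis_lborel_scale[OF finite_perp_basis assms(2,3), of \<xi>] card_perp_basis[OF assms(1)]
  by (simp add: perp_lborel_def)

text \<open>The cylinder of height 1 over the unit ball of the hyperplane lies in the ball of radius
  2, so slicing bounds its base by a finite volume.\<close>

lemma emeasure_perp_lborel_cball:
  fixes \<xi> :: "'a::euclidean_space"
  assumes "norm \<xi> = 1"
  shows "emeasure (perp_lborel \<xi>) (cball 0 1) \<noteq> \<infinity>" (is "?m \<noteq> _")
proof -
  have "?m = (\<integral>\<^sup>+t. indicator {0..1::real} t * ?m \<partial>lborel)"
    by (simp add: nn_integral_multc)
  also have "\<dots> \<le> (\<integral>\<^sup>+t. (\<integral>\<^sup>+y. indicator (cball 0 2) (t *\<^sub>R \<xi> + y) \<partial>perp_lborel \<xi>) \<partial>lborel)"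
  proof (rule nn_integral_mono)
    fix t :: real
    have "indicator {0..1} t * ?m = (\<integral>\<^sup>+y. indicator {0..1} t * indicator (cball 0 1) y \<partial>perp_lborel \<xi>)"
      by (simp add: nn_integral_cmult)
    also have "\<dots> \<le> (\<integral>\<^sup>+y. indicator (cball 0 2) (t *\<^sub>R \<xi> + y) \<partial>perp_lborel \<xi>)"
      using assms by (intro nn_integral_mono) (auto simp: indicator_def intro: norm_triangle_le)
    finally show "indicator {0..1} t * ?m \<le> (\<integral>\<^sup>+y. indicator (cball 0 2) (t *\<^sub>R \<xi> + y) \<partial>perp_lborel \<xi>)" .
  qed
  also have "\<dots> = (\<integral>\<^sup>+x. indicator (cball (0::'a) 2) x \<partial>lborel)"
    by (rule nn_integral_lborel_slice[symmetric]) (simp_all add: assms)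
  also have "\<dots> < \<infinity>"
    by (simp add: emeasure_cball)
  finally show ?thesis by simp
qed

text \<open>Guarantees that the constant in front of the averaged integral does not vanish. If the
  punctured ball were null, every slice of the unit ball orthogonal to \<open>\<xi>\<close> would be
  null, and the unit ball would have volume 0.\<close>

lemma emeasure_perp_lborel_punctured:
  fixes \<xi> :: "'a::euclidean_space"
  assumes \<xi>: "norm \<xi> = 1" and dim: "DIM('a) \<ge> 2"
  shows "emeasure (perp_lborel \<xi>) (cball 0 1 - {0}) \<noteq> 0" (is "?m \<noteq> 0")
proof
  assume "?m = 0"
  let ?z = "emeasure (perp_lborel \<xi>) {0}"
  have "?z \<le> emeasure (perp_lborel \<xi>) (cball 0 1)"
    by (intro emeasure_mono) auto
  then have fin: "?z \<noteq> top"
    using emeasure_perp_lborel_cball[OF \<xi>] by (auto simp: top_unique)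
  \<comment> \<open>Doubling fixes the origin but multiplies measure by 2^(n-1), which exceeds 1 for
    n >= 2; so the origin is a null set.\<close>
  have "ennreal (2 ^ (DIM('a) - 1)) * (\<integral>\<^sup>+x. indicator {0} (2 *\<^sub>R x) \<partial>perp_lborel \<xi>) = (\<integral>\<^sup>+x. indicator {0} x \<partial>perp_lborel \<xi>)"
    by (rule perp_lborel_scale) (simp_all add: \<xi>)
  also have "(\<lambda>x::'a. indicator {0} (2 *\<^sub>R x) :: ennreal) = indicator {0}"
    by (auto simp: indicator_def fun_eq_iff)
  finally have z: "ennreal (2 ^ (DIM('a) - 1)) * ?z = 1 * ?z"
    by simp
  have "?z = 0"
  proof (rule ccontr)
    assume "?z \<noteq> 0"
    from mult_right_cancel_ennreal[OF z this fin] have "(2::real) ^ (DIM('a) - 1) = 1"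
      by (simp flip: ennreal_1)
    moreover have "1 < (2::real) ^ (DIM('a) - 1)"
      using dim by (intro one_less_power) auto
    ultimately show False by simp
  qed
  have "emeasure (perp_lborel \<xi>) (cball 0 l) = 0" if l: "l > 0" for l
  proof -
    have "emeasure (perp_lborel \<xi>) (cball 0 l) = (\<integral>\<^sup>+x. indicator (cball 0 l) x \<partial>perp_lborel \<xi>)"
      by simp
    also have "\<dots> = ennreal (l ^ (DIM('a) - 1)) * (\<integral>\<^sup>+x. indicator (cball 0 l) (l *\<^sub>R x) \<partial>perp_lborel \<xi>)"
      using l \<xi> by (intro perp_lborel_scale[symmetric]) simp_all
    also have "(\<lambda>x::'a. indicator (cball 0 l) (l *\<^sub>R x) :: ennreal) = indicator (cball 0 1)"
      using l by (auto simp: indicator_def fun_eq_iff)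
    also have "(\<integral>\<^sup>+x. indicator (cball 0 1) x \<partial>perp_lborel \<xi>) = emeasure (perp_lborel \<xi>) (insert 0 (cball 0 1 - {0}))"
      by (simp add: insert_absorb)
    also have "\<dots> = 0"
      using \<open>?z = 0\<close> \<open>?m = 0\<close> by (subst emeasure_insert) auto
    finally show ?thesis by simp
  qed
  note null = this[of 1]
  have "emeasure lborel (cball (0::'a) 1) = (\<integral>\<^sup>+x. indicator (cball (0::'a) 1) x \<partial>lborel)"
    by simp
  also have "\<dots> = (\<integral>\<^sup>+t. (\<integral>\<^sup>+y. indicator (cball 0 1) (t *\<^sub>R \<xi> + y) \<partial>perp_lborel \<xi>) \<partial>lborel)"
    by (rule nn_integral_lborel_slice) (simp_all add: \<xi>)
  also have "\<dots> = (\<integral>\<^sup>+t. 0 \<partial>(lborel :: real measure))"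
  proof (rule nn_integral_cong)
    fix t :: real
    have "(\<integral>\<^sup>+y. indicator (cball 0 1) (t *\<^sub>R \<xi> + y) \<partial>perp_lborel \<xi>) = (\<integral>\<^sup>+y. indicator (cball 0 1 \<inter> {y. y \<bullet> \<xi> = 0}) y * indicator (cball 0 1) (t *\<^sub>R \<xi> + y) \<partial>perp_lborel \<xi>)"
      unfolding perp_lborel_def
    proof (rule nn_integral_basis_lborel_cong_span)
      fix y assume "y \<in> span (perp_basis \<xi>)"
      then have y: "y \<bullet> \<xi> = 0" by (simp add: span_perp_basis perp_def)
      \<comment> \<open>Orthogonal projection does not increase the norm, so each slice of the unit
        ball projects into the unit ball of the hyperplane.\<close>
      have "(norm y)\<^sup>2 \<le> (norm (t *\<^sub>R \<xi> + y))\<^sup>2"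
        using norm_slice[OF \<xi> y, of t] by simp
      then have "norm y \<le> norm (t *\<^sub>R \<xi> + y)" by (rule power2_le_imp_le) simp
      then show "indicator (cball 0 1) (t *\<^sub>R \<xi> + y) = indicator (cball 0 1 \<inter> {y. y \<bullet> \<xi> = 0}) y * (indicator (cball 0 1) (t *\<^sub>R \<xi> + y) :: ennreal)"
        using y by (auto simp: indicator_def)
    qed measurable
    also have "\<dots> \<le> (\<integral>\<^sup>+y. indicator (cball 0 1) y \<partial>perp_lborel \<xi>)"
      by (intro nn_integral_mono) (auto simp: indicator_def)
    also have "\<dots> = 0"
      using null by simp
    finally show "(\<integral>\<^sup>+y. indicator (cball 0 1) (t *\<^sub>R \<xi> + y) \<partial>perp_lborel \<xi>) = 0" by simp
  qed
  finally show False using emeasure_unit_cball(1)[where 'a='a] by simp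
qed

lemma nn_integral_spherical_measure_perp:
  fixes f :: "'a::euclidean_space \<Rightarrow> ennreal"
  assumes f [measurable]: "f \<in> borel_measurable borel"
  shows "(\<integral>\<^sup>+\<theta>. f \<theta> \<partial>spherical_measure (perp \<xi>)) =
    of_nat (dim (perp \<xi>)) * (\<integral>\<^sup>+y. indicator (cball 0 1 - {0}) y * f (sgn y) \<partial>perp_lborel \<xi>)"
proof -
  let ?V = "perp \<xi>" and ?W = "cball (0::'a) 1 - {0}"
  let ?R = "restrict_space (subspace_lborel ?V) ?W"
  have W: "?W \<inter> space (subspace_lborel ?V) \<in> sets (subspace_lborel ?V)"
  proof -
    have "?W \<inter> ?V = ?V \<inter> ?W" by blast
    then show ?thesis
      unfolding space_subspace_lborel sets_subspace_lborel sets_restrict_space by simp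
  qed
  have fr: "f \<in> borel_measurable (restrict_space borel (sphere 0 1 \<inter> ?V))"
    by (rule measurable_restrict_space1) (rule f)
  have sl: "subspace_lborel ?V = distr (\<Pi>\<^sub>M b\<in>perp_basis \<xi>. lborel) (restrict_space borel ?V) (\<lambda>c. \<Sum>b\<in>perp_basis \<xi>. c b *\<^sub>R b)"
    by (simp add: subspace_lborel_def perp_basis_def Let_def)
  have h: "(\<lambda>y. f (sgn y) * indicator ?W y) \<in> borel_measurable (restrict_space borel ?V)"
    by (rule measurable_restrict_space1) measurable
  have "(\<integral>\<^sup>+\<theta>. f \<theta> \<partial>spherical_measure ?V) = of_nat (dim ?V) * (\<integral>\<^sup>+\<theta>. f \<theta> \<partial>distr ?R (restrict_space borel (sphere 0 1 \<inter> ?V)) sgn)"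
    unfolding spherical_measure_def by (rule nn_integral_scale_measure) (simp add: fr cong: measurable_cong_sets)
  also have "(\<integral>\<^sup>+\<theta>. f \<theta> \<partial>distr ?R (restrict_space borel (sphere 0 1 \<inter> ?V)) sgn) = (\<integral>\<^sup>+y. f (sgn y) \<partial>?R)"
    by (rule nn_integral_distr) (use measurable_sgn_sphere[OF subspace_perp] fr in simp_all)
  also have "\<dots> = (\<integral>\<^sup>+y. f (sgn y) * indicator ?W y \<partial>subspace_lborel ?V)"
    by (rule nn_integral_restrict_space[OF W])
  also have "\<dots> = (\<integral>\<^sup>+c. f (sgn (\<Sum>b\<in>perp_basis \<xi>. c b *\<^sub>R b)) * indicator ?W (\<Sum>b\<in>perp_basis \<xi>. c b *\<^sub>R b) \<partial>(\<Pi>\<^sub>M b\<in>perp_basis \<xi>. lborel))"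
    unfolding sl by (rule nn_integral_distr) (use measurable_subspace_coords[OF perp_basis] h in simp_all)
  also have "\<dots> = (\<integral>\<^sup>+y. f (sgn y) * indicator ?W y \<partial>perp_lborel \<xi>)"
    unfolding perp_lborel_def by (rule nn_integral_basis_lborel[symmetric]) measurable
  finally show ?thesis by (simp add: mult.commute)
qed

section \<open>Dual section functions as volume integrals\<close>

text \<open>\<open>GREATEST\<close> is meaningful only if a maximum exists: compactness supplies it,
  and convexity makes the admissible parameters a full interval starting at 0.\<close>

lemma radial_function_translate:
  fixes K :: "'a::euclidean_space set"
  assumes K: "compact K" "convex K" and p: "p \<in> K" and \<theta>: "norm \<theta> = 1"
  defines "\<rho> \<equiv> radial_function ((\<lambda>x. x - p) ` K) \<theta>"
  shows "0 \<le> \<rho>" and "\<And>a. 0 \<le> a \<Longrightarrow> a \<le> \<rho> \<longleftrightarrow> p + a *\<^sub>R \<theta> \<in> K"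
proof -
  have mem: "a *\<^sub>R \<theta> \<in> (\<lambda>x. x - p) ` K \<longleftrightarrow> p + a *\<^sub>R \<theta> \<in> K" for a
    by (auto simp: image_iff algebra_simps)
  define S where "S = {a. 0 \<le> a \<and> p + a *\<^sub>R \<theta> \<in> K}"
  obtain D where D: "\<And>x. x \<in> K \<Longrightarrow> norm x \<le> D"
    using compact_imp_bounded[OF K(1)] by (auto simp: bounded_iff)
  have "S \<subseteq> {0..D + norm p}"
  proof
    fix a assume a: "a \<in> S"
    have "norm (a *\<^sub>R \<theta>) \<le> norm (p + a *\<^sub>R \<theta>) + norm p"
      using norm_triangle_sub[of "a *\<^sub>R \<theta>" "p + a *\<^sub>R \<theta>"] by simp
    also have "\<dots> \<le> D + norm p"
      using D a by (auto simp: S_def)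
    finally show "a \<in> {0..D + norm p}"
      using a \<theta> by (auto simp: S_def)
  qed
  then have "bounded S"
    using bounded_closed_interval bounded_subset by blast
  moreover have "closed S"
  proof -
    have "S = {0..} \<inter> (\<lambda>a. p + a *\<^sub>R \<theta>) -` K"
      by (auto simp: S_def)
    moreover have "closed ((\<lambda>a. p + a *\<^sub>R \<theta>) -` K)"
      by (rule closed_vimage) (auto intro!: continuous_intros compact_imp_closed K)
    ultimately show ?thesis by auto
  qed
  ultimately have "compact S" by (simp add: compact_eq_bounded_closed)
  moreover have "0 \<in> S" using p by (simp add: S_def)
  ultimately obtain s where s: "s \<in> S" "\<And>a. a \<in> S \<Longrightarrow> a \<le> s"
    using compact_attains_sup[of S] by auto
  have \<rho>: "\<rho> = s"
    unfolding \<rho>_def radial_function_def mem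
    by (rule Greatest_equality) (use s in \<open>auto simp: S_def\<close>)
  show "0 \<le> \<rho>" using s \<rho> by (auto simp: S_def)
  fix a :: real assume a: "0 \<le> a"
  show "a \<le> \<rho> \<longleftrightarrow> p + a *\<^sub>R \<theta> \<in> K"
  proof
    assume "p + a *\<^sub>R \<theta> \<in> K"
    then show "a \<le> \<rho>" using s(2)[of a] a by (simp add: S_def \<rho>)
  next
    assume le: "a \<le> \<rho>"
    show "p + a *\<^sub>R \<theta> \<in> K"
    proof (cases "s = 0")
      case True
      then show ?thesis using a le p \<rho> by simp
    next
      case False
      then have "s > 0" using s(1) by (simp add: S_def)
      have "(1 - a / s) *\<^sub>R p + (a / s) *\<^sub>R (p + s *\<^sub>R \<theta>) \<in> K"
        using K(2) p s(1) \<open>s > 0\<close> a le \<rho> by (intro convexD) (auto simp: S_def)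
      also have "(1 - a / s) *\<^sub>R p + (a / s) *\<^sub>R (p + s *\<^sub>R \<theta>) = p + a *\<^sub>R \<theta>"
        using False by (simp add: algebra_simps)
      finally show ?thesis .
    qed
  qed
qed

text \<open>For \<open>p\<close> in a compact convex \<open>K\<close> this is the m-th power of the
  radial function about \<open>p\<close>, written as the integral of its derivative along the ray.
  In this form measurability in the direction is immediate, which \<open>GREATEST\<close> does not
  give.\<close>

definition radial_power :: "'a::euclidean_space set \<Rightarrow> nat \<Rightarrow> 'a \<Rightarrow> 'a \<Rightarrow> ennreal" where
  "radial_power K m p \<theta> =
     (\<integral>\<^sup>+r. indicator {0<..} r * (ennreal (real m * r ^ (m - 1)) * indicator K (p + r *\<^sub>R \<theta>)) \<partial>lborel)"

lemma nn_integral_power_Ioc: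
  fixes \<rho> :: real
  assumes "m > 0" "\<rho> \<ge> 0"
  shows "(\<integral>\<^sup>+r. indicator {0<..\<rho>} r * ennreal (real m * r ^ (m - 1)) \<partial>lborel) = ennreal (\<rho> ^ m)"
proof -
  have "(\<integral>\<^sup>+r. indicator {0<..\<rho>} r * ennreal (real m * r ^ (m - 1)) \<partial>lborel) =
      (\<integral>\<^sup>+r. ennreal (real m * r ^ (m - 1)) * indicator {0..\<rho>} r \<partial>lborel)"
    by (intro nn_integral_cong_AE) (use AE_lborel_singleton[of "0::real"] in eventually_elim, auto simp: indicator_def)
  also have "\<dots> = ennreal (\<rho> ^ m - 0 ^ m)"
    using assms by (intro nn_integral_FTC_Icc[where F="\<lambda>r. r ^ m"])
      (auto intro!: derivative_eq_intros has_field_derivative_at_within)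
  finally show ?thesis using assms by (simp add: power_0_left)
qed

lemma radial_power_eq:
  fixes K :: "'a::euclidean_space set"
  assumes K: "compact K" "convex K" and p: "p \<in> K" and \<theta>: "norm \<theta> = 1" and m: "m > 0"
  shows "radial_power K m p \<theta> = ennreal (radial_function ((\<lambda>x. x - p) ` K) \<theta> ^ m)"
proof -
  note \<rho> = radial_function_translate[OF K p \<theta>]
  have "radial_power K m p \<theta> = (\<integral>\<^sup>+r. indicator {0<..radial_function ((\<lambda>x. x - p) ` K) \<theta>} r * ennreal (real m * r ^ (m - 1)) \<partial>lborel)"
    unfolding radial_power_def by (intro nn_integral_cong) (auto simp: indicator_def \<rho>(2))
  then show ?thesis
    using nn_integral_power_Ioc[OF m \<rho>(1)] by simp
qed

lemma borel_measurable_radial_power [measurable]: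
  assumes [measurable]: "K \<in> sets borel"
  shows "radial_power K m p \<in> borel_measurable borel"
  unfolding radial_power_def by measurable

text \<open>Moves the definition from the Bochner integral over the sphere to a nonnegative integral
  over the punctured unit ball of the hyperplane.\<close>

lemma dual_section_function_eq:
  fixes K :: "'a::euclidean_space set"
  assumes dim: "DIM('a) \<ge> 2" and m: "m > 0" and \<xi>: "norm \<xi> = 1"
    and K: "compact K" "convex K" and t: "t *\<^sub>R \<xi> \<in> K"
  shows "ennreal (dual_section_function K m \<xi> t) =
      (\<integral>\<^sup>+u. indicator (cball 0 1 - {0}) u * radial_power K m (t *\<^sub>R \<xi>) (sgn u) \<partial>perp_lborel \<xi>)" (is "_ = ?X")
    and "0 \<le> dual_section_function K m \<xi> t"
proof -
  let ?\<rho> = "\<lambda>\<theta>. radial_function ((\<lambda>x. x - t *\<^sub>R \<xi>) ` K) \<theta>"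
  let ?S = "spherical_measure (perp \<xi>)"
  have [measurable]: "K \<in> sets borel" using K(1) by (simp add: compact_imp_closed)
  have sets: "sets ?S = sets (restrict_space borel (sphere 0 1 \<inter> perp \<xi>))"
    by (simp add: spherical_measure_def)
  have space: "space ?S = sphere 0 1 \<inter> perp \<xi>"
    using sets_eq_imp_space_eq[OF sets] by (simp add: space_restrict_space)
  have rp: "radial_power K m (t *\<^sub>R \<xi>) \<theta> = ennreal (?\<rho> \<theta> ^ m)" if "\<theta> \<in> space ?S" for \<theta>
    using that by (intro radial_power_eq K t m) (auto simp: space)
  have nonneg: "0 \<le> ?\<rho> \<theta> ^ m" if "\<theta> \<in> space ?S" for \<theta>
    using that radial_function_translate(1)[OF K t, of \<theta>] by (auto simp: space)
  have meas: "radial_power K m (t *\<^sub>R \<xi>) \<in> borel_measurable ?S"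
    unfolding measurable_cong_sets[OF sets refl] by (rule measurable_restrict_space1) measurable
  \<comment> \<open>The radial function inherits measurability from \<open>radial_power\<close>,
    with which its m-th power agrees on the sphere.\<close>
  have "(\<lambda>\<theta>. enn2real (radial_power K m (t *\<^sub>R \<xi>) \<theta>)) \<in> borel_measurable ?S"
    using meas by measurable
  also have "?this \<longleftrightarrow> (\<lambda>\<theta>. ?\<rho> \<theta> ^ m) \<in> borel_measurable ?S"
    by (rule measurable_cong) (simp add: rp nonneg)
  finally have meas': "(\<lambda>\<theta>. ?\<rho> \<theta> ^ m) \<in> borel_measurable ?S" .
  have "(\<integral>\<theta>. ?\<rho> \<theta> ^ m \<partial>?S) = enn2real (\<integral>\<^sup>+\<theta>. ennreal (?\<rho> \<theta> ^ m) \<partial>?S)"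
    by (rule integral_eq_nn_integral[OF meas']) (use nonneg in auto)
  also have "(\<integral>\<^sup>+\<theta>. ennreal (?\<rho> \<theta> ^ m) \<partial>?S) = (\<integral>\<^sup>+\<theta>. radial_power K m (t *\<^sub>R \<xi>) \<theta> \<partial>?S)"
    by (intro nn_integral_cong) (simp add: rp)
  also have "\<dots> = of_nat (DIM('a) - 1) * ?X"
    by (subst nn_integral_spherical_measure_perp) (simp_all add: dim_perp[OF \<xi>])
  finally have "dual_section_function K m \<xi> t = 1 / (real DIM('a) - 1) * enn2real (of_nat (DIM('a) - 1) * ?X)"
    unfolding dual_section_function_def perp_def[symmetric] by simp
  \<comment> \<open>The factor n - 1 built into the spherical measure cancels the normalisation 1 /
    (n - 1).\<close>
  also have "\<dots> = enn2real ?X"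
    using dim by (simp add: enn2real_mult of_nat_diff)
  finally have eq: "dual_section_function K m \<xi> t = enn2real ?X" .
  then show "0 \<le> dual_section_function K m \<xi> t" by simp
  \<comment> \<open>\<open>enn2real\<close> sends infinity to 0, so the \<open>ennreal\<close>
    identity also needs a finite right-hand side; boundedness of \<open>K\<close> bounds the radial
    function about any of its points.\<close>
  obtain D where D: "\<And>x. x \<in> K \<Longrightarrow> norm x \<le> D"
    using compact_imp_bounded[OF K(1)] by (auto simp: bounded_iff)
  have bound: "radial_power K m (t *\<^sub>R \<xi>) (sgn u) \<le> ennreal ((D + norm (t *\<^sub>R \<xi>)) ^ m)" if "u \<noteq> 0" for u
  proof -
    have n: "norm (sgn u) = 1" using that by (simp add: norm_sgn)
    note \<rho> = radial_function_translate[OF K t n]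
    have "t *\<^sub>R \<xi> + ?\<rho> (sgn u) *\<^sub>R sgn u \<in> K"
      using \<rho> by blast
    then have "norm (t *\<^sub>R \<xi> + ?\<rho> (sgn u) *\<^sub>R sgn u) \<le> D" by (rule D)
    moreover have "norm (?\<rho> (sgn u) *\<^sub>R sgn u) \<le> norm (t *\<^sub>R \<xi> + ?\<rho> (sgn u) *\<^sub>R sgn u) + norm (t *\<^sub>R \<xi>)"
      using norm_triangle_sub[of "?\<rho> (sgn u) *\<^sub>R sgn u" "t *\<^sub>R \<xi> + ?\<rho> (sgn u) *\<^sub>R sgn u"] by simp
    ultimately have "?\<rho> (sgn u) \<le> D + norm (t *\<^sub>R \<xi>)"
      using n \<rho>(1) by simp
    then show ?thesis
      unfolding radial_power_eq[OF K t n m] using \<rho>(1) by (intro ennreal_leI power_mono)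
  qed
  have "?X \<le> (\<integral>\<^sup>+u. ennreal ((D + norm (t *\<^sub>R \<xi>)) ^ m) * indicator (cball 0 1) u \<partial>perp_lborel \<xi>)"
    using bound by (intro nn_integral_mono) (auto simp: indicator_def)
  also have "\<dots> < \<infinity>"
    using emeasure_perp_lborel_cball[OF \<xi>] by (simp add: nn_integral_cmult ennreal_mult_less_top top.not_eq_extremum)
  finally show "ennreal (dual_section_function K m \<xi> t) = ?X"
    by (simp add: eq)
qed

text \<open>The density with exponent m - (n - 1), which may be negative and is therefore written as
  a quotient. For m > 0 its value at 0 is 0, as the polar coordinate formula requires.\<close>

definition weight :: "nat \<Rightarrow> 'a::euclidean_space \<Rightarrow> ennreal" where
  "weight m y = ennreal (norm y ^ m / norm y ^ (DIM('a) - 1))"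

lemma borel_measurable_weight [measurable]: "weight m \<in> borel_measurable borel"
  unfolding weight_def by measurable

text \<open>Polar coordinates in the hyperplane, of dimension d = n - 1: the Jacobian d r^(d-1)
  times the weight r^(m-d) is d / m times m r^(m-1), the density of
  \<open>radial_power\<close>.\<close>

lemma nn_integral_radial_power:
  fixes K :: "'a::euclidean_space set"
  assumes dim: "DIM('a) \<ge> 2" and m: "m > 0" and \<xi>: "norm \<xi> = 1" and [measurable]: "K \<in> sets borel"
  shows "(\<integral>\<^sup>+u. indicator (cball 0 1 - {0}) u * radial_power K m p (sgn u) \<partial>perp_lborel \<xi>) =
    ennreal (m / (DIM('a) - 1)) * (\<integral>\<^sup>+y. weight m y * indicator K (p + y) \<partial>perp_lborel \<xi>)"
proof -
  let ?d = "DIM('a) - 1"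
  have "(\<integral>\<^sup>+y. weight m y * indicator K (p + y) \<partial>perp_lborel \<xi>) =
      (\<integral>\<^sup>+u. indicator (cball 0 1) u * (\<integral>\<^sup>+r. indicator {0<..} r * (ennreal (real ?d * r ^ (?d - 1)) *
        (weight m (r *\<^sub>R sgn u) * indicator K (p + r *\<^sub>R sgn u))) \<partial>lborel) \<partial>perp_lborel \<xi>)"
  proof (rule nn_integral_polar)
    show "weight m 0 * indicator K (p + 0) = 0" using m by (simp add: weight_def)
  qed (use dim perp_lborel_scale[OF \<xi>] emeasure_perp_lborel_cball[OF \<xi>] in auto)
  also have "\<dots> = (\<integral>\<^sup>+u. ennreal (?d / m) * (indicator (cball 0 1 - {0}) u * radial_power K m p (sgn u)) \<partial>perp_lborel \<xi>)"
  proof (rule nn_integral_cong)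
    fix u :: 'a
    show "indicator (cball 0 1) u * (\<integral>\<^sup>+r. indicator {0<..} r * (ennreal (real ?d * r ^ (?d - 1)) *
        (weight m (r *\<^sub>R sgn u) * indicator K (p + r *\<^sub>R sgn u))) \<partial>lborel) =
        ennreal (?d / m) * (indicator (cball 0 1 - {0}) u * radial_power K m p (sgn u))"
    proof (cases "u = 0")
      case True
      then show ?thesis using m by (simp add: weight_def power_0_left)
    next
      case False
      then have n: "norm (sgn u) = 1" by (simp add: norm_sgn)
      have "(\<integral>\<^sup>+r. indicator {0<..} r * (ennreal (real ?d * r ^ (?d - 1)) *
        (weight m (r *\<^sub>R sgn u) * indicator K (p + r *\<^sub>R sgn u))) \<partial>lborel) =
        (\<integral>\<^sup>+r. ennreal (?d / m) * (indicator {0<..} r * (ennreal (real m * r ^ (m - 1)) * indicator K (p + r *\<^sub>R sgn u))) \<partial>lborel)"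
      proof (rule nn_integral_cong)
        fix r :: real
        show "indicator {0<..} r * (ennreal (real ?d * r ^ (?d - 1)) * (weight m (r *\<^sub>R sgn u) * indicator K (p + r *\<^sub>R sgn u))) =
            ennreal (?d / m) * (indicator {0<..} r * (ennreal (real m * r ^ (m - 1)) * indicator K (p + r *\<^sub>R sgn u)))"
        proof (cases "r > 0")
          case True
          obtain e where e: "?d = Suc e" using dim by (cases ?d) auto
          obtain k where k: "m = Suc k" using m by (cases m) auto
          have "real ?d * r ^ (?d - 1) * (r ^ m / r ^ ?d) = ?d / m * (real m * r ^ (m - 1))"
            unfolding e k using True by (simp add: field_simps del: of_nat_Suc)
          then have "ennreal (real ?d * r ^ (?d - 1)) * ennreal (r ^ m / r ^ ?d) = ennreal (?d / m) * ennreal (real m * r ^ (m - 1))"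
            using True by (simp add: ennreal_mult[symmetric])
          then show ?thesis
            using True n by (simp add: weight_def mult.assoc[symmetric])
        qed simp
      qed
      also have "\<dots> = ennreal (?d / m) * radial_power K m p (sgn u)"
        unfolding radial_power_def by (rule nn_integral_cmult) measurable
      finally show ?thesis using False by (simp add: indicator_def)
    qed
  qed
  also have "\<dots> = ennreal (?d / m) * (\<integral>\<^sup>+u. indicator (cball 0 1 - {0}) u * radial_power K m p (sgn u) \<partial>perp_lborel \<xi>)"
    by (rule nn_integral_cmult) measurable
  finally have "ennreal (m / ?d) * (\<integral>\<^sup>+y. weight m y * indicator K (p + y) \<partial>perp_lborel \<xi>) =
      (ennreal (m / ?d) * ennreal (?d / m)) * (\<integral>\<^sup>+u. indicator (cball 0 1 - {0}) u * radial_power K m p (sgn u) \<partial>perp_lborel \<xi>)"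
    by (simp add: mult.assoc)
  also have "ennreal (m / ?d) * ennreal (?d / m) = 1"
    using m dim by (simp add: ennreal_mult[symmetric] flip: ennreal_1)
  finally show ?thesis by simp
qed

text \<open>The weight is evaluated at the component of x orthogonal to \<open>\<xi>\<close>, so it
  depends on the distance to the axis. Writing this over the whole space puts point and direction
  into one formula and lets Tonelli exchange them.\<close>

definition slab_integral :: "'a::euclidean_space set \<Rightarrow> nat \<Rightarrow> real \<Rightarrow> 'a \<Rightarrow> ennreal" where
  "slab_integral K m T \<xi> =
     (\<integral>\<^sup>+x. indicator {0..T} (x \<bullet> \<xi>) * weight m (x - (x \<bullet> \<xi>) *\<^sub>R \<xi>) * indicator K x \<partial>lborel)"

text \<open>Fubini along \<open>\<xi>\<close>: on the hyperplane at height t the orthogonal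
  component of t \<open>\<xi>\<close> + y is y, which leaves the weighted integral of the
  section.\<close>

lemma nn_integral_dual_section_function:
  fixes K :: "'a::euclidean_space set"
  assumes dim: "DIM('a) \<ge> 2" and m: "m > 0" and \<xi>: "norm \<xi> = 1"
    and K: "compact K" "convex K" and t: "\<And>t. 0 \<le> t \<Longrightarrow> t \<le> T \<Longrightarrow> t *\<^sub>R \<xi> \<in> K"
  shows "(\<integral>\<^sup>+t. indicator {0..T} t * ennreal (dual_section_function K m \<xi> t) \<partial>lborel) =
    ennreal (m / (DIM('a) - 1)) * slab_integral K m T \<xi>"
proof -
  have [measurable]: "K \<in> sets borel" using K(1) by (simp add: compact_imp_closed)
  let ?c = "ennreal (m / (DIM('a) - 1))"
  let ?Y = "\<lambda>t. \<integral>\<^sup>+y. weight m y * indicator K (t *\<^sub>R \<xi> + y) \<partial>perp_lborel \<xi>"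
  have [measurable]: "?Y \<in> borel_measurable borel"
    unfolding perp_lborel_def by (rule borel_measurable_nn_integral_basis_lborel[OF finite_perp_basis]) measurable
  have "(\<integral>\<^sup>+t. indicator {0..T} t * ennreal (dual_section_function K m \<xi> t) \<partial>lborel) =
      (\<integral>\<^sup>+t. ?c * (indicator {0..T} t * ?Y t) \<partial>lborel)"
  proof (rule nn_integral_cong)
    fix t :: real
    show "indicator {0..T} t * ennreal (dual_section_function K m \<xi> t) = ?c * (indicator {0..T} t * ?Y t)"
    proof (cases "t \<in> {0..T}")
      case True
      then show ?thesis
        using t[of t] by (simp only: dual_section_function_eq(1)[OF dim m \<xi> K] nn_integral_radial_power[OF dim m \<xi>] atLeastAtMost_iff)
          (simp add: nn_integral_radial_power[OF dim m \<xi>])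
    qed simp
  qed
  also have "\<dots> = ?c * (\<integral>\<^sup>+t. indicator {0..T} t * ?Y t \<partial>lborel)"
    by (rule nn_integral_cmult) measurable
  also have "(\<integral>\<^sup>+t. indicator {0..T} t * ?Y t \<partial>lborel) = slab_integral K m T \<xi>"
  proof -
    have "slab_integral K m T \<xi> = (\<integral>\<^sup>+t. (\<integral>\<^sup>+y. indicator {0..T} ((t *\<^sub>R \<xi> + y) \<bullet> \<xi>) *
        weight m ((t *\<^sub>R \<xi> + y) - ((t *\<^sub>R \<xi> + y) \<bullet> \<xi>) *\<^sub>R \<xi>) * indicator K (t *\<^sub>R \<xi> + y) \<partial>perp_lborel \<xi>) \<partial>lborel)"
      unfolding slab_integral_def by (rule nn_integral_lborel_slice[OF \<xi>]) measurable
    also have "\<dots> = (\<integral>\<^sup>+t. (\<integral>\<^sup>+y. indicator {0..T} t * (weight m y * indicator K (t *\<^sub>R \<xi> + y)) \<partial>perp_lborel \<xi>) \<partial>lborel)"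
    proof (rule nn_integral_cong)
      fix t :: real
      show "(\<integral>\<^sup>+y. indicator {0..T} ((t *\<^sub>R \<xi> + y) \<bullet> \<xi>) *
        weight m ((t *\<^sub>R \<xi> + y) - ((t *\<^sub>R \<xi> + y) \<bullet> \<xi>) *\<^sub>R \<xi>) * indicator K (t *\<^sub>R \<xi> + y) \<partial>perp_lborel \<xi>) =
        (\<integral>\<^sup>+y. indicator {0..T} t * (weight m y * indicator K (t *\<^sub>R \<xi> + y)) \<partial>perp_lborel \<xi>)"
        unfolding perp_lborel_def
      proof (rule nn_integral_basis_lborel_cong_span)
        fix y assume "y \<in> span (perp_basis \<xi>)"
        then have "(t *\<^sub>R \<xi> + y) \<bullet> \<xi> = t"
          using \<xi> by (simp add: span_perp_basis perp_def inner_add_left norm_eq_1)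
        then show "indicator {0..T} ((t *\<^sub>R \<xi> + y) \<bullet> \<xi>) *
            weight m ((t *\<^sub>R \<xi> + y) - ((t *\<^sub>R \<xi> + y) \<bullet> \<xi>) *\<^sub>R \<xi>) * indicator K (t *\<^sub>R \<xi> + y) =
            indicator {0..T} t * (weight m y * indicator K (t *\<^sub>R \<xi> + y))"
          by (simp add: mult.assoc)
      qed measurable
    qed
    also have "\<dots> = (\<integral>\<^sup>+t. indicator {0..T} t * ?Y t \<partial>lborel)"
      by (intro nn_integral_cong nn_integral_cmult) measurable
    finally show ?thesis by simp
  qed
  finally show ?thesis .
qed

section \<open>Averaging over the directions\<close>

text \<open>Here the point is fixed and the direction is integrated, the reverse of
  \<open>slab_integral\<close>.\<close>

definition slab_kernel :: "nat \<Rightarrow> real \<Rightarrow> 'a::euclidean_space \<Rightarrow> ennreal" where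
  "slab_kernel m T x =
     (\<integral>\<^sup>+u. indicator (cball 0 1 - {0}) u *
       (indicator {0..T} (x \<bullet> sgn u) * weight m (x - (x \<bullet> sgn u) *\<^sub>R sgn u)) \<partial>lborel)"

lemma borel_measurable_slab_kernel [measurable]: "slab_kernel m T \<in> borel_measurable borel"
  unfolding slab_kernel_def by measurable

lemma nn_integral_slab_integral:
  fixes K :: "'a::euclidean_space set"
  assumes [measurable]: "K \<in> sets borel"
  shows "(\<integral>\<^sup>+u. indicator (cball 0 1 - {0}) u * slab_integral K m T (sgn u) \<partial>lborel) =
    (\<integral>\<^sup>+x. indicator K x * slab_kernel m T x \<partial>lborel)"
proof -
  let ?B = "cball (0::'a) 1 - {0}"
  let ?f = "\<lambda>u x. indicator ?B u * (indicator {0..T} (x \<bullet> sgn u) * weight m (x - (x \<bullet> sgn u) *\<^sub>R sgn u) * indicator K x)"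
  have "(\<integral>\<^sup>+u. indicator ?B u * slab_integral K m T (sgn u) \<partial>lborel) = (\<integral>\<^sup>+u. (\<integral>\<^sup>+x. ?f u x \<partial>lborel) \<partial>lborel)"
    unfolding slab_integral_def by (intro nn_integral_cong nn_integral_cmult[symmetric]) measurable
  also have "\<dots> = (\<integral>\<^sup>+x. (\<integral>\<^sup>+u. ?f u x \<partial>lborel) \<partial>lborel)"
    by (rule lborel_pair.Fubini') measurable
  also have "\<dots> = (\<integral>\<^sup>+x. indicator K x * slab_kernel m T x \<partial>lborel)"
  proof (rule nn_integral_cong)
    fix x
    have "(\<integral>\<^sup>+u. ?f u x \<partial>lborel) = (\<integral>\<^sup>+u. indicator K x * (indicator ?B u * (indicator {0..T} (x \<bullet> sgn u) * weight m (x - (x \<bullet> sgn u) *\<^sub>R sgn u))) \<partial>lborel)"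
      by (intro nn_integral_cong) (simp only: mult_ac)
    also have "\<dots> = indicator K x * slab_kernel m T x"
      unfolding slab_kernel_def by (rule nn_integral_cmult) measurable
    finally show "(\<integral>\<^sup>+u. ?f u x \<partial>lborel) = indicator K x * slab_kernel m T x" .
  qed
  finally show ?thesis .
qed

lemma orthogonal_transformation_sgn:
  "orthogonal_transformation Q \<Longrightarrow> sgn (Q u) = Q (sgn u)"
  by (simp add: sgn_div_norm orthogonal_transformation_norm orthogonal_transformation_linear linear_scale)

lemma weight_cong: "norm (x::'a::euclidean_space) = norm y \<Longrightarrow> weight m x = weight m (y::'a)"
  by (simp add: weight_def)

lemma orthogonal_transformation_rejection:
  fixes Q :: "'a::euclidean_space \<Rightarrow> 'a"
  assumes Q: "orthogonal_transformation Q"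
  shows "weight m (Q x - (Q x \<bullet> Q s) *\<^sub>R Q s) = weight m (x - (x \<bullet> s) *\<^sub>R s)"
proof (rule weight_cong)
  have lin: "linear Q" using Q by (rule orthogonal_transformation_linear)
  have "Q x \<bullet> Q s = x \<bullet> s" using Q by (simp add: orthogonal_transformation_def)
  then have "Q x - (Q x \<bullet> Q s) *\<^sub>R Q s = Q (x - (x \<bullet> s) *\<^sub>R s)"
    by (simp add: linear_diff[OF lin] linear_scale[OF lin])
  then show "norm (Q x - (Q x \<bullet> Q s) *\<^sub>R Q s) = norm (x - (x \<bullet> s) *\<^sub>R s)"
    using Q by (simp add: orthogonal_transformation_norm)
qed

text \<open>Some orthogonal map carries x to y, and applying it to the integration variable as well
  leaves all inner products and distances in the integrand unchanged.\<close>

lemma slab_kernel_radial: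
  fixes x y :: "real^'n"
  assumes "norm x = norm y"
  shows "slab_kernel m T x = slab_kernel m T y"
proof -
  obtain Q where Q: "orthogonal_transformation Q" and y: "Q x = y"
    using orthogonal_transformation_exists[OF assms] by metis
  have inner: "Q a \<bullet> Q b = a \<bullet> b" for a b
    using Q by (simp add: orthogonal_transformation_def)
  let ?f = "\<lambda>u. indicator (cball 0 1 - {0}) u *
       (indicator {0..T} (y \<bullet> sgn u) * weight m (y - (y \<bullet> sgn u) *\<^sub>R sgn u))"
  have "slab_kernel m T y = (\<integral>\<^sup>+u. ?f (Q u) \<partial>lborel)"
    unfolding slab_kernel_def by (rule nn_integral_lborel_orthogonal[symmetric, OF Q]) measurable
  also have "\<dots> = slab_kernel m T x"
    unfolding slab_kernel_def
  proof (rule nn_integral_cong)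
    fix u
    have "Q u = 0 \<longleftrightarrow> u = 0"
      using orthogonal_transformation_norm[OF Q, of u] by (metis norm_eq_zero)
    then have "indicator (cball 0 1 - {0}) (Q u) = (indicator (cball 0 1 - {0}) u :: ennreal)"
      using orthogonal_transformation_norm[OF Q, of u] by (simp add: indicator_def)
    then show "?f (Q u) = indicator (cball 0 1 - {0}) u *
       (indicator {0..T} (x \<bullet> sgn u) * weight m (x - (x \<bullet> sgn u) *\<^sub>R sgn u))"
      by (simp only: y[symmetric] orthogonal_transformation_sgn[OF Q] inner[of x] orthogonal_transformation_rejection[OF Q, of m x, unfolded inner])
  qed
  finally show ?thesis by simp
qed

text \<open>The same substitution, now in the point x: a centred ball looks alike from all
  directions, so averaging over directions changes nothing. This is what makes balls suitable test
  bodies.\<close>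

lemma slab_integral_cball:
  fixes \<xi> \<eta> :: "real^'n"
  assumes "norm \<xi> = norm \<eta>"
  shows "slab_integral (cball 0 \<rho>) m T \<xi> = slab_integral (cball 0 \<rho>) m T \<eta>"
proof -
  obtain Q where Q: "orthogonal_transformation Q" and \<eta>: "Q \<xi> = \<eta>"
    using orthogonal_transformation_exists[OF assms] by metis
  have inner: "Q a \<bullet> Q b = a \<bullet> b" for a b
    using Q by (simp add: orthogonal_transformation_def)
  let ?f = "\<lambda>x. indicator {0..T} (x \<bullet> \<eta>) * weight m (x - (x \<bullet> \<eta>) *\<^sub>R \<eta>) * indicator (cball 0 \<rho>) x"
  have "slab_integral (cball 0 \<rho>) m T \<eta> = (\<integral>\<^sup>+x. ?f (Q x) \<partial>lborel)"
    unfolding slab_integral_def by (rule nn_integral_lborel_orthogonal[symmetric, OF Q]) measurable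
  also have "\<dots> = slab_integral (cball 0 \<rho>) m T \<xi>"
    unfolding slab_integral_def
  proof (rule nn_integral_cong)
    fix x
    have "indicator (cball 0 \<rho>) (Q x) = (indicator (cball 0 \<rho>) x :: ennreal)"
      using orthogonal_transformation_norm[OF Q, of x] by (simp add: indicator_def)
    then show "?f (Q x) = indicator {0..T} (x \<bullet> \<xi>) * weight m (x - (x \<bullet> \<xi>) *\<^sub>R \<xi>) * indicator (cball 0 \<rho>) x"
      by (simp only: \<eta>[symmetric] inner[of x] orthogonal_transformation_rejection[OF Q, of m x, unfolded inner])
  qed
  finally show ?thesis by simp
qed

section \<open>Sections of balls and the integrals of the kernel over balls\<close>

lemma radial_function_cball:
  fixes \<xi> \<theta> :: "'a::euclidean_space"
  assumes \<xi>: "norm \<xi> = 1" and \<theta>: "norm \<theta> = 1" "\<theta> \<bullet> \<xi> = 0" and t: "0 \<le> t" "t \<le> \<rho>"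
  shows "radial_function ((\<lambda>x. x - t *\<^sub>R \<xi>) ` cball 0 \<rho>) \<theta> = sqrt (\<rho>\<^sup>2 - t\<^sup>2)" (is "?r = ?s")
proof -
  have p: "t *\<^sub>R \<xi> \<in> cball 0 \<rho>" using \<xi> t by simp
  note r = radial_function_translate[OF compact_cball convex_cball p \<theta>(1)]
  have le: "t\<^sup>2 \<le> \<rho>\<^sup>2" using t by (rule power_mono[rotated])
  have iff: "a \<le> ?r \<longleftrightarrow> a \<le> ?s" if a: "0 \<le> a" for a
  proof -
    have "a \<le> ?r \<longleftrightarrow> norm (t *\<^sub>R \<xi> + a *\<^sub>R \<theta>) \<le> \<rho>"
      using r(2)[OF a] by simp
    also have "\<dots> \<longleftrightarrow> (norm (t *\<^sub>R \<xi> + a *\<^sub>R \<theta>))\<^sup>2 \<le> \<rho>\<^sup>2"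
      using t by (intro iffI power_mono) (auto intro: power2_le_imp_le)
    also have "\<dots> \<longleftrightarrow> a\<^sup>2 \<le> \<rho>\<^sup>2 - t\<^sup>2"
      using norm_slice[OF \<xi>, of "a *\<^sub>R \<theta>" t] \<theta> by auto
    also have "\<dots> \<longleftrightarrow> a \<le> ?s"
    proof
      assume "a \<le> ?s"
      then have "a\<^sup>2 \<le> ?s\<^sup>2" using a by (rule power_mono)
      then show "a\<^sup>2 \<le> \<rho>\<^sup>2 - t\<^sup>2" using le by simp
    qed (rule real_le_rsqrt)
    finally show ?thesis .
  qed
  have "0 \<le> ?s" using le by simp
  then show ?thesis
    using iff[OF r(1)] iff[of ?s] by (intro antisym) auto
qed

text \<open>The section at height t is a ball about t \<open>\<xi>\<close>, so its radial function
  is constant and leaves only the measure of the punctured unit ball of the hyperplane.\<close>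

lemma nn_integral_dual_section_cball:
  fixes \<xi> :: "'a::euclidean_space"
  assumes dim: "DIM('a) \<ge> 2" and m: "m > 0" and \<xi>: "norm \<xi> = 1" and T: "0 \<le> T" "T \<le> \<rho>"
  shows "ennreal (m / (DIM('a) - 1)) * slab_integral (cball 0 \<rho>) m T \<xi> =
    emeasure (perp_lborel \<xi>) (cball 0 1 - {0}) *
    (\<integral>\<^sup>+t. indicator {0..T} t * ennreal (sqrt (\<rho>\<^sup>2 - t\<^sup>2) ^ m) \<partial>lborel)"
proof -
  let ?b = "emeasure (perp_lborel \<xi>) (cball 0 1 - {0})"
  have in_ball: "t *\<^sub>R \<xi> \<in> cball 0 \<rho>" if "0 \<le> t" "t \<le> T" for t
    using that T \<xi> by simp
  have dual: "ennreal (dual_section_function (cball 0 \<rho>) m \<xi> t) = ?b * ennreal (sqrt (\<rho>\<^sup>2 - t\<^sup>2) ^ m)"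
    if t: "0 \<le> t" "t \<le> T" for t
  proof -
    have "ennreal (dual_section_function (cball 0 \<rho>) m \<xi> t) =
      (\<integral>\<^sup>+u. indicator (cball 0 1 - {0}) u * radial_power (cball 0 \<rho>) m (t *\<^sub>R \<xi>) (sgn u) \<partial>perp_lborel \<xi>)"
      by (rule dual_section_function_eq(1)[OF dim m \<xi> compact_cball convex_cball in_ball[OF t]])
    also have "\<dots> = (\<integral>\<^sup>+u. indicator (cball 0 1 - {0}) u * ennreal (sqrt (\<rho>\<^sup>2 - t\<^sup>2) ^ m) \<partial>perp_lborel \<xi>)"
      unfolding perp_lborel_def
    proof (rule nn_integral_basis_lborel_cong_span)
      fix u assume "u \<in> span (perp_basis \<xi>)"
      then have u: "u \<bullet> \<xi> = 0" by (simp add: span_perp_basis perp_def)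
      show "indicator (cball 0 1 - {0}) u * radial_power (cball 0 \<rho>) m (t *\<^sub>R \<xi>) (sgn u) =
          indicator (cball 0 1 - {0}) u * ennreal (sqrt (\<rho>\<^sup>2 - t\<^sup>2) ^ m)"
      proof (cases "u = 0")
        case False
        then have n: "norm (sgn u) = 1" by (simp add: norm_sgn)
        have "sgn u \<bullet> \<xi> = 0" using u by (simp add: sgn_div_norm)
        with n show ?thesis
          using t T by (simp only: radial_power_eq[OF compact_cball convex_cball in_ball[OF t] n m]
              radial_function_cball[OF \<xi> n _ t(1) order_trans[OF t(2) T(2)]])
      qed simp
    qed measurable
    also have "\<dots> = ?b * ennreal (sqrt (\<rho>\<^sup>2 - t\<^sup>2) ^ m)"
      by (subst nn_integral_multc) simp_all
    finally show ?thesis .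
  qed
  have "ennreal (m / (DIM('a) - 1)) * slab_integral (cball 0 \<rho>) m T \<xi> =
      (\<integral>\<^sup>+t. indicator {0..T} t * ennreal (dual_section_function (cball 0 \<rho>) m \<xi> t) \<partial>lborel)"
    by (rule nn_integral_dual_section_function[symmetric, OF dim m \<xi> compact_cball convex_cball in_ball])
  also have "\<dots> = (\<integral>\<^sup>+t. ?b * (indicator {0..T} t * ennreal (sqrt (\<rho>\<^sup>2 - t\<^sup>2) ^ m)) \<partial>lborel)"
    by (intro nn_integral_cong) (auto simp: indicator_def dual)
  also have "\<dots> = ?b * (\<integral>\<^sup>+t. indicator {0..T} t * ennreal (sqrt (\<rho>\<^sup>2 - t\<^sup>2) ^ m) \<partial>lborel)"
    by (rule nn_integral_cmult) measurable
  finally show ?thesis .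
qed

text \<open>The radial part, in polar coordinates, of the integral of the kernel up to radius
  \<open>\<rho>\<close>. As the kernel depends on the norm alone, it is sampled along the ray of one
  fixed unit vector \<open>e\<close>.\<close>

definition slab_radial :: "'a::euclidean_space \<Rightarrow> nat \<Rightarrow> real \<Rightarrow> real \<Rightarrow> ennreal" where
  "slab_radial e m T \<rho> =
     (\<integral>\<^sup>+r. indicator {0<..\<rho>} r * (ennreal (real DIM('a) * r ^ (DIM('a) - 1)) * slab_kernel m T (r *\<^sub>R e)) \<partial>lborel)"

lemma nn_integral_slab_kernel:
  fixes K :: "(real^'n) set" and e :: "real^'n"
  assumes K: "compact K" "convex K" "0 \<in> K" and m: "m > 0" and e: "norm e = 1"
  shows "(\<integral>\<^sup>+x. indicator K x * slab_kernel m T x \<partial>lborel) =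
    (\<integral>\<^sup>+w. indicator (cball 0 1 - {0}) w * slab_radial e m T (radial_function K (sgn w)) \<partial>lborel)"
proof -
  have [measurable]: "K \<in> sets borel" using K(1) by (simp add: compact_imp_closed)
  let ?n = "DIM(real^'n)"
  have k0: "slab_kernel m T (0 :: real^'n) = 0"
    using m by (simp add: slab_kernel_def weight_def power_0_left)
  have "(\<integral>\<^sup>+x. indicator K x * slab_kernel m T x \<partial>lborel) =
      (\<integral>\<^sup>+w. indicator (cball 0 1) w * (\<integral>\<^sup>+r. indicator {0<..} r * (ennreal (real ?n * r ^ (?n - 1)) *
        (indicator K (r *\<^sub>R sgn w) * slab_kernel m T (r *\<^sub>R sgn w))) \<partial>lborel) \<partial>lborel)"
  proof (rule nn_integral_polar)
    fix g :: "real^'n \<Rightarrow> ennreal" and l :: real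
    assume "g \<in> borel_measurable borel" "l > 0"
    then show "ennreal (l ^ ?n) * (\<integral>\<^sup>+x. g (l *\<^sub>R x) \<partial>lborel) = (\<integral>\<^sup>+x. g x \<partial>lborel)"
      using nn_integral_basis_lborel_scale[of "Basis :: (real^'n) set" l g] by (simp add: basis_lborel_Basis)
  qed (use emeasure_unit_cball(2)[where 'a="real^'n"] k0 in auto)
  also have "\<dots> = (\<integral>\<^sup>+w. indicator (cball 0 1 - {0}) w * slab_radial e m T (radial_function K (sgn w)) \<partial>lborel)"
  proof (rule nn_integral_cong)
    fix w :: "real^'n"
    show "indicator (cball 0 1) w * (\<integral>\<^sup>+r. indicator {0<..} r * (ennreal (real ?n * r ^ (?n - 1)) *
        (indicator K (r *\<^sub>R sgn w) * slab_kernel m T (r *\<^sub>R sgn w))) \<partial>lborel) =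
        indicator (cball 0 1 - {0}) w * slab_radial e m T (radial_function K (sgn w))"
    proof (cases "w = 0")
      case True
      then show ?thesis by (simp add: k0)
    next
      case False
      then have n: "norm (sgn w) = 1" by (simp add: norm_sgn)
      have "r \<le> radial_function K (sgn w) \<longleftrightarrow> r *\<^sub>R sgn w \<in> K" if "0 \<le> r" for r
        using radial_function_translate(2)[OF K n that] by simp
      moreover have "slab_kernel m T (r *\<^sub>R sgn w) = slab_kernel m T (r *\<^sub>R e)" for r
        using n e by (intro slab_kernel_radial) simp
      ultimately have "(\<integral>\<^sup>+r. indicator {0<..} r * (ennreal (real ?n * r ^ (?n - 1)) *
        (indicator K (r *\<^sub>R sgn w) * slab_kernel m T (r *\<^sub>R sgn w))) \<partial>lborel) = slab_radial e m T (radial_function K (sgn w))"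
        unfolding slab_radial_def by (intro nn_integral_cong) (auto simp: indicator_def)
      then show ?thesis using False by (simp add: indicator_def)
    qed
  qed
  finally show ?thesis .
qed

text \<open>Identifies the radial integral by evaluating the average for one ball in two ways:
  through polar coordinates and as an average over directions of a constant. The volume of the unit
  ball is a common factor and cancels.\<close>

lemma slab_radial_eq:
  fixes e :: "real^'n"
  assumes m: "m > 0" and e: "norm e = 1" and \<rho>: "\<rho> \<ge> 0"
  shows "slab_radial e m T \<rho> = slab_integral (cball 0 \<rho>) m T e"
proof -
  let ?B = "cball 0 1 - {0} :: (real^'n) set"
  let ?v = "emeasure lborel ?B"
  have v: "?v = emeasure lborel (cball (0 :: real^'n) 1)"
    by (subst emeasure_Diff) (auto simp: emeasure_lborel_countable)
  have rad: "radial_function (cball 0 \<rho>) (sgn w) = \<rho>" if "w \<noteq> 0" for w :: "real^'n"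
  proof -
    have n: "norm (sgn w) = 1" using that by (simp add: norm_sgn)
    have "0 \<in> cball (0::real^'n) \<rho>" using \<rho> by simp
    note r = radial_function_translate[OF compact_cball convex_cball this n]
    show ?thesis
      using r(1) r(2)[OF r(1)] r(2)[OF \<rho>] n \<rho> by (intro antisym) auto
  qed
  have "?v * slab_radial e m T \<rho> = (\<integral>\<^sup>+w. indicator ?B w * slab_radial e m T \<rho> \<partial>lborel)"
    by (subst nn_integral_multc) simp_all
  also have "\<dots> = (\<integral>\<^sup>+w. indicator ?B w * slab_radial e m T (radial_function (cball 0 \<rho>) (sgn w)) \<partial>lborel)"
    by (intro nn_integral_cong) (auto simp: indicator_def rad)
  also have "\<dots> = (\<integral>\<^sup>+x. indicator (cball (0::real^'n) \<rho>) x * slab_kernel m T x \<partial>lborel)"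
    using \<rho> by (intro nn_integral_slab_kernel[symmetric] m e) auto
  also have "\<dots> = (\<integral>\<^sup>+u. indicator ?B u * slab_integral (cball 0 \<rho>) m T (sgn u) \<partial>lborel)"
    by (rule nn_integral_slab_integral[symmetric]) simp
  also have "\<dots> = (\<integral>\<^sup>+u. indicator ?B u * slab_integral (cball 0 \<rho>) m T e \<partial>lborel)"
  proof (rule nn_integral_cong)
    fix u :: "real^'n"
    show "indicator ?B u * slab_integral (cball 0 \<rho>) m T (sgn u) = indicator ?B u * slab_integral (cball 0 \<rho>) m T e"
    proof (cases "u = 0")
      case False
      then have "norm (sgn u) = norm e" using e by (simp add: norm_sgn)
      from slab_integral_cball[OF this] show ?thesis by simp
    qed simp
  qed
  also have "\<dots> = ?v * slab_integral (cball 0 \<rho>) m T e"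
    by (subst nn_integral_multc) simp_all
  finally have "slab_radial e m T \<rho> * ?v = slab_integral (cball 0 \<rho>) m T e * ?v"
    by (simp only: mult.commute)
  then show ?thesis
    by (rule mult_right_cancel_ennreal) (simp_all add: v emeasure_unit_cball)
qed

text \<open>At w = 0 the admissible parameters are unbounded and \<open>GREATEST\<close> has no
  specified value, hence a measurable version that agrees away from 0.\<close>

lemma borel_measurable_radial_function_sgn:
  fixes K :: "'a::euclidean_space set"
  assumes K: "compact K" "convex K" "0 \<in> K"
  obtains g :: "'a \<Rightarrow> real" where "g \<in> borel_measurable borel"
    and "\<And>w. w \<noteq> 0 \<Longrightarrow> g w = radial_function K (sgn w)"
proof
  have [measurable]: "K \<in> sets borel" using K(1) by (simp add: compact_imp_closed)
  show "(\<lambda>w. enn2real (radial_power K 1 0 (sgn w))) \<in> borel_measurable borel"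
    by measurable
  fix w :: 'a assume "w \<noteq> 0"
  then have n: "norm (sgn w) = 1" by (simp add: norm_sgn)
  show "enn2real (radial_power K 1 0 (sgn w)) = radial_function K (sgn w)"
    using radial_power_eq[OF K n, of 1] radial_function_translate(1)[OF K n] by simp
qed

text \<open>
  The average of the left-hand sides is the integral over \<open>K\<close> of a kernel depending only on \<open>norm x\<close>, so in
  polar coordinates only the integrals of the kernel over balls enter, and these are explicit.
\<close>

theorem nn_integral_dual_section_average:
  fixes K :: "(real^'n) set" and e :: "real^'n"
  assumes dim: "CARD('n) \<ge> 2" and m: "m > 0" and e: "norm e = 1"
    and K: "compact K" "convex K" and T: "0 \<le> T" "cball 0 T \<subseteq> K"
  shows "(\<integral>\<^sup>+u. indicator (cball 0 1 - {0}) u *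
      (\<integral>\<^sup>+t. indicator {0..T} t * ennreal (dual_section_function K m (sgn u) t) \<partial>lborel) \<partial>lborel) =
    (\<integral>\<^sup>+u. indicator (cball 0 1 - {0}) u * (emeasure (perp_lborel e) (cball 0 1 - {0}) *
      (\<integral>\<^sup>+t. indicator {0..T} t * ennreal (sqrt ((radial_function K (sgn u))\<^sup>2 - t\<^sup>2) ^ m) \<partial>lborel)) \<partial>lborel)"
    (is "?L = ?R")
proof -
  have [measurable]: "K \<in> sets borel" using K(1) by (simp add: compact_imp_closed)
  have dim': "DIM(real^'n) \<ge> 2" using dim by simp
  have 0: "0 \<in> K" using T by auto
  let ?c = "ennreal (m / (DIM(real^'n) - 1))"
  let ?B = "cball 0 1 - {0} :: (real^'n) set"
  have [measurable]: "slab_integral K m T \<in> borel_measurable borel"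
    unfolding slab_integral_def by measurable
  obtain g where [measurable]: "g \<in> borel_measurable borel" and g: "\<And>w. w \<noteq> 0 \<Longrightarrow> g w = radial_function K (sgn w)"
    using borel_measurable_radial_function_sgn[OF K 0] by metis
  have [measurable]: "slab_radial e m T \<in> borel_measurable borel"
    unfolding slab_radial_def indicator_def greaterThanAtMost_iff by measurable
  have "(\<lambda>w. indicator ?B w * slab_radial e m T (g w)) \<in> borel_measurable borel"
    by measurable
  also have "(\<lambda>w. indicator ?B w * slab_radial e m T (g w)) = (\<lambda>w. indicator ?B w * slab_radial e m T (radial_function K (sgn w)))"
    using g by (auto simp: indicator_def fun_eq_iff)
  finally have meas: "(\<lambda>w. indicator ?B w * slab_radial e m T (radial_function K (sgn w))) \<in> borel_measurable borel" .
  have "?L = (\<integral>\<^sup>+u. ?c * (indicator ?B u * slab_integral K m T (sgn u)) \<partial>lborel)"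
  proof (rule nn_integral_cong)
    fix u :: "real^'n"
    show "indicator ?B u * (\<integral>\<^sup>+t. indicator {0..T} t * ennreal (dual_section_function K m (sgn u) t) \<partial>lborel) =
        ?c * (indicator ?B u * slab_integral K m T (sgn u))"
    proof (cases "u = 0")
      case False
      then have n: "norm (sgn u) = 1" by (simp add: norm_sgn)
      have "t *\<^sub>R sgn u \<in> K" if "0 \<le> t" "t \<le> T" for t
        using that T(2) n by auto
      from nn_integral_dual_section_function[OF dim' m n K this] show ?thesis
        by (simp only: mult_ac)
    qed simp
  qed
  also have "\<dots> = ?c * (\<integral>\<^sup>+u. indicator ?B u * slab_integral K m T (sgn u) \<partial>lborel)"
    by (rule nn_integral_cmult) measurable
  also have "\<dots> = ?c * (\<integral>\<^sup>+w. indicator ?B w * slab_radial e m T (radial_function K (sgn w)) \<partial>lborel)"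
    by (simp only: nn_integral_slab_integral[OF \<open>K \<in> sets borel\<close>] nn_integral_slab_kernel[OF K 0 m e])
  also have "\<dots> = (\<integral>\<^sup>+w. ?c * (indicator ?B w * slab_radial e m T (radial_function K (sgn w))) \<partial>lborel)"
    by (rule nn_integral_cmult[symmetric]) (simp add: meas)
  also have "\<dots> = ?R"
  proof (rule nn_integral_cong)
    fix u :: "real^'n"
    show "?c * (indicator ?B u * slab_radial e m T (radial_function K (sgn u))) =
        indicator ?B u * (emeasure (perp_lborel e) (cball 0 1 - {0}) *
        (\<integral>\<^sup>+t. indicator {0..T} t * ennreal (sqrt ((radial_function K (sgn u))\<^sup>2 - t\<^sup>2) ^ m) \<partial>lborel))"
    proof (cases "u = 0")
      case False
      then have n: "norm (sgn u) = 1" by (simp add: norm_sgn)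
      have "T *\<^sub>R sgn u \<in> K" using T n by auto
      then have le: "T \<le> radial_function K (sgn u)"
        using radial_function_translate(2)[OF K 0 n T(1)] by simp
      \<comment> \<open>In this direction \<open>K\<close> is replaced by the ball of radius
        \<open>radial_function K (sgn u)\<close>. The ball formula applies because T does not exceed
        that radius.\<close>
      have "?c * slab_radial e m T (radial_function K (sgn u)) = emeasure (perp_lborel e) (cball 0 1 - {0}) *
          (\<integral>\<^sup>+t. indicator {0..T} t * ennreal (sqrt ((radial_function K (sgn u))\<^sup>2 - t\<^sup>2) ^ m) \<partial>lborel)"
        using slab_radial_eq[OF m e order_trans[OF T(1) le], of T] nn_integral_dual_section_cball[OF dim' m e T(1) le]
        by simp
      then show ?thesis by (simp only: mult.left_commute[of ?c])
    qed simp
  qed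
  finally show ?thesis .
qed

section \<open>Non-polynomiality of the average\<close>

text \<open>Near 0 a nonzero polynomial behaves like a nonzero multiple of T^k, where k is the order
  of its zero there and is at most its degree; the bounds would force k to be at least
  \<open>L\<close>.\<close>

lemma poly_not_between_powers:
  fixes p :: "real poly"
  assumes deg: "degree p < L" and "s > 0" "\<delta> > 0"
    and bounds: "\<And>T. 0 < T \<Longrightarrow> T \<le> s \<Longrightarrow> \<delta> * T ^ L \<le> poly p T \<and> poly p T \<le> C * T ^ L"
  shows False
proof -
  have "p \<noteq> 0"
  proof
    assume "p = 0"
    moreover have "0 < \<delta> * s ^ L" using assms(2,3) by simp
    ultimately show False using bounds[of s] assms(2) by simp
  qed
  define k where "k = order 0 p"
  obtain q where q: "p = [:- 0, 1:] ^ k * q" "\<not> [:- 0, 1:] dvd q"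
    using order_decomp[OF \<open>p \<noteq> 0\<close>, of 0] k_def by auto
  have q0: "poly q 0 \<noteq> 0"
    using q(2) by (simp add: poly_eq_0_iff_dvd)
  have "k < L"
    using order_degree[OF \<open>p \<noteq> 0\<close>, of 0] deg k_def by simp
  \<comment> \<open>After division by T^k the upper bound still contains a positive power of T, so
    the quotient is squeezed to 0 although q does not vanish at 0.\<close>
  have "0 < poly q T \<and> poly q T \<le> C * T ^ (L - k)" if T: "0 < T" "T \<le> s" for T
  proof -
    have eq: "poly p T = T ^ k * poly q T"
      by (subst q) simp
    have "T ^ L = T ^ k * T ^ (L - k)"
      using \<open>k < L\<close> by (simp flip: power_add)
    with bounds[OF T] eq have "T ^ k * (\<delta> * T ^ (L - k)) \<le> T ^ k * poly q T" "T ^ k * poly q T \<le> T ^ k * (C * T ^ (L - k))"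
      by (simp_all add: mult_ac)
    then have "\<delta> * T ^ (L - k) \<le> poly q T" "poly q T \<le> C * T ^ (L - k)"
      using T by (simp_all add: mult_le_cancel_left)
    moreover have "0 < \<delta> * T ^ (L - k)" using T assms(3) by simp
    ultimately show ?thesis by linarith
  qed
  then have ev: "eventually (\<lambda>T. 0 \<le> poly q T \<and> poly q T \<le> C * T ^ (L - k)) (at_right 0)"
    using \<open>s > 0\<close> unfolding eventually_at_right_field by (intro exI[of _ s]) (auto intro: less_imp_le)
  have "((\<lambda>T. C * T ^ (L - k)) \<longlongrightarrow> C * 0 ^ (L - k)) (at_right 0)"
    by (intro tendsto_intros)
  then have lim0: "((\<lambda>T. C * T ^ (L - k)) \<longlongrightarrow> 0) (at_right 0)"
    using \<open>k < L\<close> by (simp add: power_0_left)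
  have "(poly q \<longlongrightarrow> 0) (at_right 0)"
    by (rule tendsto_sandwich[OF _ _ tendsto_const lim0]) (use ev in \<open>auto elim: eventually_mono\<close>)
  moreover have "(poly q \<longlongrightarrow> poly q 0) (at_right 0)"
    by (rule tendsto_poly) (rule tendsto_ident_at)
  ultimately show False
    using q0 tendsto_unique trivial_limit_at_right_real by blast
qed

text \<open>
  Since \<open>m\<close> is odd, the falling product is never zero, so all Taylor coefficients of \<open>(1 - x) powr (m / 2)\<close>
  survive; for \<open>M > m\<close> the remainder is comparable to \<open>x ^ M\<close> and has constant sign.
\<close>

lemma taylor_remainder_bounds:
  fixes m M :: nat
  assumes "odd m" "m < M"
  obtains \<delta> \<epsilon> :: real and c :: "nat \<Rightarrow> real" and C :: real
  where "\<delta> > 0" and "\<And>x. 0 \<le> x \<Longrightarrow> x \<le> 1 / 4 \<Longrightarrow>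
      \<delta> * x ^ M \<le> \<epsilon> * ((1 - x) powr (m / 2) - (\<Sum>i<M. c i * x ^ i)) \<and>
      \<epsilon> * ((1 - x) powr (m / 2) - (\<Sum>i<M. c i * x ^ i)) \<le> C * x ^ M"
proof -
  define a where "a = real m / 2"
  \<comment> \<open>\<open>P i\<close> is the Pochhammer symbol of -a: the signs from
    differentiating 1 - x are absorbed, so \<open>diff i\<close> is the i-th derivative of (1 - x)^a
    and P i / i! its Taylor coefficient.\<close>
  define P where "P i = (\<Prod>l<i. real l - a)" for i
  define diff where "diff i x = P i * (1 - x) powr (a - real i)" for i x
  define q where "q = P M / fact M"
  have "real l - a \<noteq> 0" for l
  proof
    assume "real l - a = 0"
    then have "real m = real (2 * l)" by (simp add: a_def)
    then have "m = 2 * l" by (simp only: of_nat_eq_iff)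
    with assms(1) show False by simp
  qed
  then have q0: "q \<noteq> 0" by (simp add: q_def P_def)
  have aM: "a - real M < 0" using assms(2) by (simp add: a_def)
  have deriv: "(diff i has_real_derivative diff (Suc i) t) (at t)" if "t < 1" for i t
  proof -
    have "((\<lambda>x. P i * (1 - x) powr (a - real i)) has_real_derivative
        P i * ((a - real i) * (1 - t) powr (a - real i - 1) * (- 1))) (at t)"
      using that by (auto intro!: derivative_eq_intros)
    moreover have "P i * ((a - real i) * (1 - t) powr (a - real i - 1) * (- 1)) = diff (Suc i) t"
      by (simp add: diff_def P_def algebra_simps)
    ultimately show ?thesis by (simp add: diff_def[abs_def])
  qed
  show thesis
  \<comment> \<open>\<open>sgn q\<close> makes the remainder nonnegative. The exponent a - M is
    negative and the intermediate point t is at most 1/4, so the power of 1 - t lies between 1 and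
    its value at 3/4; this gives both constants.\<close>
  proof (rule that[of "\<bar>q\<bar>" "sgn q" "\<lambda>i. P i / fact i" "\<bar>q\<bar> * (3 / 4) powr (a - real M)"])
    show "\<bar>q\<bar> > 0" using q0 by simp
    fix x :: real assume x: "0 \<le> x" "x \<le> 1 / 4"
    let ?r = "(1 - x) powr (real m / 2) - (\<Sum>i<M. P i / fact i * x ^ i)"
    have "\<exists>t. 0 \<le> t \<and> t \<le> 1 / 4 \<and> ?r = q * (1 - t) powr (a - real M) * x ^ M"
    proof (cases "x = 0")
      case True
      have "M > 0" using assms by simp
      moreover have "(\<Sum>i<M. P i / fact i * 0 ^ i) = (\<Sum>i<M. if i = 0 then 1 else 0)"
        by (intro sum.cong) (auto simp: P_def)
      ultimately show ?thesis
        using True by (intro exI[of _ 0]) (simp add: power_0_left)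
    next
      case False
      with x have "x > 0" by simp
      then obtain t where t: "0 < t" "t \<le> x"
        "diff 0 x = (\<Sum>i<M. diff i 0 / fact i * x ^ i) + diff M t / fact M * x ^ M"
        using Maclaurin2[of x diff "diff 0" M] deriv x by auto
      then have "?r = q * (1 - t) powr (a - real M) * x ^ M"
        by (simp add: diff_def a_def q_def P_def)
      then show ?thesis using t x by (intro exI[of _ t]) auto
    qed
    then obtain t where t: "0 \<le> t" "t \<le> 1 / 4" and r: "?r = q * (1 - t) powr (a - real M) * x ^ M"
      by blast
    have s: "sgn q * ?r = \<bar>q\<bar> * ((1 - t) powr (a - real M) * x ^ M)"
      unfolding r by (simp add: abs_sgn mult_ac)
    have "1 \<le> (1 - t) powr (a - real M)"
      using t aM powr_mono2'[of "a - real M" "1 - t" 1] by simp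
    moreover have "(1 - t) powr (a - real M) \<le> (3 / 4) powr (a - real M)"
      using t aM by (intro powr_mono2') auto
    moreover have "0 \<le> x ^ M" using x by simp
    ultimately have "x ^ M \<le> (1 - t) powr (a - real M) * x ^ M" "(1 - t) powr (a - real M) * x ^ M \<le> (3 / 4) powr (a - real M) * x ^ M"
      using mult_right_mono[of 1 "(1 - t) powr (a - real M)" "x ^ M"]
      by (simp_all add: mult_right_mono)
    then show "\<bar>q\<bar> * x ^ M \<le> sgn q * ?r \<and> sgn q * ?r \<le> \<bar>q\<bar> * (3 / 4) powr (a - real M) * x ^ M"
      unfolding s by (auto simp: mult.assoc intro: mult_left_mono)
  qed
qed

text \<open>Homogeneity: with x = (t / \<open>\<rho>\<close>)^2 the left side is
  \<open>\<rho>\<close>^m (1 - x)^(m/2), and t <= \<open>\<rho>\<close> / 2 means x <= 1/4. The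
  constants do not depend on \<open>\<rho>\<close>, so the bounds can later be averaged.\<close>

lemma sqrt_power_expansion:
  fixes m M :: nat
  assumes "odd m" "m < M"
  obtains \<delta> \<epsilon> :: real and c :: "nat \<Rightarrow> real" and C :: real
  where "\<delta> > 0" and "\<And>\<rho> t. 0 < \<rho> \<Longrightarrow> 0 \<le> t \<Longrightarrow> t \<le> \<rho> / 2 \<Longrightarrow>
      \<delta> * (\<rho> ^ m / \<rho> ^ (2 * M)) * t ^ (2 * M) \<le>
        \<epsilon> * (sqrt (\<rho>\<^sup>2 - t\<^sup>2) ^ m - (\<Sum>i<M. c i * (\<rho> ^ m / \<rho> ^ (2 * i)) * t ^ (2 * i))) \<and>
      \<epsilon> * (sqrt (\<rho>\<^sup>2 - t\<^sup>2) ^ m - (\<Sum>i<M. c i * (\<rho> ^ m / \<rho> ^ (2 * i)) * t ^ (2 * i))) \<le>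
        C * (\<rho> ^ m / \<rho> ^ (2 * M)) * t ^ (2 * M)"
proof -
  obtain \<delta> \<epsilon> c C where "\<delta> > 0" and bounds: "\<And>x. 0 \<le> x \<Longrightarrow> x \<le> 1 / 4 \<Longrightarrow>
      \<delta> * x ^ M \<le> \<epsilon> * ((1 - x) powr (m / 2) - (\<Sum>i<M. c i * x ^ i)) \<and>
      \<epsilon> * ((1 - x) powr (m / 2) - (\<Sum>i<M. c i * x ^ i)) \<le> C * x ^ M"
    by (rule taylor_remainder_bounds[OF assms]) blast
  show thesis
  proof (rule that[OF \<open>\<delta> > 0\<close>, of \<epsilon> c C])
    fix \<rho> t :: real assume \<rho>: "0 < \<rho>" and t: "0 \<le> t" "t \<le> \<rho> / 2"
    define x where "x = (t / \<rho>)\<^sup>2"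
    have "t / \<rho> \<le> 1 / 2" using t \<rho> by (simp add: field_simps)
    then have "x \<le> (1 / 2)\<^sup>2" unfolding x_def using t \<rho> by (intro power_mono) auto
    then have x: "0 \<le> x" "x \<le> 1 / 4" by (simp_all add: x_def power_divide)
    have pow: "\<rho> ^ m * x ^ i = \<rho> ^ m / \<rho> ^ (2 * i) * t ^ (2 * i)" for i
      by (simp add: x_def power_divide power_mult)
    have "sqrt (\<rho>\<^sup>2 - t\<^sup>2) = \<rho> * sqrt (1 - x)"
    proof -
      have "\<rho>\<^sup>2 - t\<^sup>2 = \<rho>\<^sup>2 * (1 - x)"
        using \<rho> by (simp add: x_def power_divide field_simps)
      then show ?thesis using \<rho> by (simp add: real_sqrt_mult)
    qed
    moreover have "sqrt (1 - x) ^ m = (1 - x) powr (m / 2)"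
      using x by (simp add: powr_half_sqrt[symmetric] powr_powr flip: powr_realpow)
    ultimately have s: "sqrt (\<rho>\<^sup>2 - t\<^sup>2) ^ m = \<rho> ^ m * (1 - x) powr (m / 2)"
      by (simp add: power_mult_distrib)
    have sum: "(\<Sum>i<M. c i * (\<rho> ^ m / \<rho> ^ (2 * i)) * t ^ (2 * i)) = \<rho> ^ m * (\<Sum>i<M. c i * x ^ i)"
      unfolding sum_distrib_left mult.assoc pow[symmetric] by (simp add: mult_ac)
    have eq: "\<epsilon> * (sqrt (\<rho>\<^sup>2 - t\<^sup>2) ^ m - (\<Sum>i<M. c i * (\<rho> ^ m / \<rho> ^ (2 * i)) * t ^ (2 * i))) =
        \<rho> ^ m * (\<epsilon> * ((1 - x) powr (m / 2) - (\<Sum>i<M. c i * x ^ i)))"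
      unfolding s sum by (simp add: algebra_simps)
    have out: "z * (\<rho> ^ m / \<rho> ^ (2 * M)) * t ^ (2 * M) = \<rho> ^ m * (z * x ^ M)" for z
      using pow[of M] by (simp add: mult_ac)
    have "\<rho> ^ m * (\<delta> * x ^ M) \<le> \<rho> ^ m * (\<epsilon> * ((1 - x) powr (m / 2) - (\<Sum>i<M. c i * x ^ i)))"
      "\<rho> ^ m * (\<epsilon> * ((1 - x) powr (m / 2) - (\<Sum>i<M. c i * x ^ i))) \<le> \<rho> ^ m * (C * x ^ M)"
      using bounds[OF x] \<rho> by (auto intro: mult_left_mono)
    then show "\<delta> * (\<rho> ^ m / \<rho> ^ (2 * M)) * t ^ (2 * M) \<le>
        \<epsilon> * (sqrt (\<rho>\<^sup>2 - t\<^sup>2) ^ m - (\<Sum>i<M. c i * (\<rho> ^ m / \<rho> ^ (2 * i)) * t ^ (2 * i))) \<and>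
      \<epsilon> * (sqrt (\<rho>\<^sup>2 - t\<^sup>2) ^ m - (\<Sum>i<M. c i * (\<rho> ^ m / \<rho> ^ (2 * i)) * t ^ (2 * i))) \<le>
        C * (\<rho> ^ m / \<rho> ^ (2 * M)) * t ^ (2 * M)"
      unfolding eq out by blast
  qed
qed

section \<open>Integrating the expansion in t\<close>

lemma nn_integral_indicator_has_integral:
  fixes f :: "'a::euclidean_space \<Rightarrow> real"
  assumes [measurable]: "f \<in> borel_measurable borel" "S \<in> sets borel"
    and nonneg: "\<And>x. x \<in> S \<Longrightarrow> 0 \<le> f x" and I: "(f has_integral I) S"
  shows "(\<integral>\<^sup>+x. indicator S x * ennreal (f x) \<partial>lborel) = ennreal I"
proof -
  have "(\<integral>\<^sup>+x. indicator S x * ennreal (f x) \<partial>lborel) = (\<integral>\<^sup>+x. ennreal (if x \<in> S then f x else 0) \<partial>lborel)"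
    by (intro nn_integral_cong) (auto simp: indicator_def)
  also have "\<dots> = ennreal I"
    by (rule nn_integral_has_integral_lborel) (use nonneg I in \<open>auto simp: has_integral_restrict_UNIV\<close>)
  finally show ?thesis .
qed

lemma has_integral_power:
  fixes T :: real
  assumes "0 \<le> T"
  shows "((\<lambda>t. t ^ k) has_integral T ^ Suc k / real (Suc k)) {0..T}"
proof -
  have "((\<lambda>t. t ^ k) has_integral T ^ Suc k / real (Suc k) - 0 ^ Suc k / real (Suc k)) {0..T}"
  proof (rule fundamental_theorem_of_calculus[OF assms])
    fix x
    have "((\<lambda>t. t ^ Suc k / real (Suc k)) has_real_derivative x ^ k) (at x)"
      by (auto intro!: derivative_eq_intros simp del: power_Suc of_nat_Suc)
    then show "((\<lambda>t. t ^ Suc k / real (Suc k)) has_vector_derivative x ^ k) (at x within {0..T})"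
      by (simp add: has_real_derivative_iff_has_vector_derivative has_vector_derivative_at_within)
  qed
  then show ?thesis by simp
qed

text \<open>Termwise integration of the preceding bounds: the coefficient of t^(2 i) is divided by 2
  i + 1, and the constants stay uniform in \<open>\<rho>\<close>.\<close>

lemma integral_sqrt_power_expansion:
  fixes m M :: nat
  assumes "odd m" "m < M"
  obtains \<delta> \<epsilon> :: real and c :: "nat \<Rightarrow> real" and C :: real
  where "\<delta> > 0" and "\<And>\<rho> T. 0 < \<rho> \<Longrightarrow> 0 \<le> T \<Longrightarrow> T \<le> \<rho> / 2 \<Longrightarrow>
      \<delta> * (\<rho> ^ m / \<rho> ^ (2 * M)) * T ^ Suc (2 * M) \<le>
        \<epsilon> * (integral {0..T} (\<lambda>t. sqrt (\<rho>\<^sup>2 - t\<^sup>2) ^ m) - (\<Sum>i<M. c i * (\<rho> ^ m / \<rho> ^ (2 * i)) * T ^ Suc (2 * i))) \<and>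
      \<epsilon> * (integral {0..T} (\<lambda>t. sqrt (\<rho>\<^sup>2 - t\<^sup>2) ^ m) - (\<Sum>i<M. c i * (\<rho> ^ m / \<rho> ^ (2 * i)) * T ^ Suc (2 * i))) \<le>
        C * (\<rho> ^ m / \<rho> ^ (2 * M)) * T ^ Suc (2 * M)"
proof -
  obtain \<delta> \<epsilon> c C where \<delta>: "\<delta> > 0" and bounds: "\<And>\<rho> t. 0 < \<rho> \<Longrightarrow> 0 \<le> t \<Longrightarrow> t \<le> \<rho> / 2 \<Longrightarrow>
      \<delta> * (\<rho> ^ m / \<rho> ^ (2 * M)) * t ^ (2 * M) \<le>
        \<epsilon> * (sqrt (\<rho>\<^sup>2 - t\<^sup>2) ^ m - (\<Sum>i<M. c i * (\<rho> ^ m / \<rho> ^ (2 * i)) * t ^ (2 * i))) \<and>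
      \<epsilon> * (sqrt (\<rho>\<^sup>2 - t\<^sup>2) ^ m - (\<Sum>i<M. c i * (\<rho> ^ m / \<rho> ^ (2 * i)) * t ^ (2 * i))) \<le>
        C * (\<rho> ^ m / \<rho> ^ (2 * M)) * t ^ (2 * M)"
    by (rule sqrt_power_expansion[OF assms]) blast
  show thesis
  proof (rule that[of "\<delta> / real (Suc (2 * M))" \<epsilon> "\<lambda>i. c i / real (Suc (2 * i))" "C / real (Suc (2 * M))"])
    show "\<delta> / real (Suc (2 * M)) > 0" using \<delta> by simp
    fix \<rho> T :: real assume \<rho>: "0 < \<rho>" and T: "0 \<le> T" "T \<le> \<rho> / 2"
    let ?s = "\<lambda>t. sqrt (\<rho>\<^sup>2 - t\<^sup>2) ^ m"
    have "(?s has_integral integral {0..T} ?s) {0..T}"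
      by (intro integrable_integral integrable_continuous_interval continuous_intros)
    then have mid: "((\<lambda>t. \<epsilon> * (?s t - (\<Sum>i<M. c i * (\<rho> ^ m / \<rho> ^ (2 * i)) * t ^ (2 * i)))) has_integral
        \<epsilon> * (integral {0..T} ?s - (\<Sum>i<M. c i * (\<rho> ^ m / \<rho> ^ (2 * i)) * (T ^ Suc (2 * i) / real (Suc (2 * i)))))) {0..T}"
      using T by (intro has_integral_mult_right has_integral_diff has_integral_sum has_integral_power) auto
    have out: "((\<lambda>t. z * (\<rho> ^ m / \<rho> ^ (2 * M)) * t ^ (2 * M)) has_integral
        z * (\<rho> ^ m / \<rho> ^ (2 * M)) * (T ^ Suc (2 * M) / real (Suc (2 * M)))) {0..T}" for z
      using T by (intro has_integral_mult_right has_integral_power)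
    have out': "z / real (Suc (2 * M)) * (\<rho> ^ m / \<rho> ^ (2 * M)) * T ^ Suc (2 * M) =
        z * (\<rho> ^ m / \<rho> ^ (2 * M)) * (T ^ Suc (2 * M) / real (Suc (2 * M)))" for z
      by (simp del: of_nat_Suc power_Suc)
    have "\<delta> * (\<rho> ^ m / \<rho> ^ (2 * M)) * (T ^ Suc (2 * M) / real (Suc (2 * M))) \<le>
        \<epsilon> * (integral {0..T} ?s - (\<Sum>i<M. c i * (\<rho> ^ m / \<rho> ^ (2 * i)) * (T ^ Suc (2 * i) / real (Suc (2 * i)))))"
      using bounds[OF \<rho>] T by (intro has_integral_le[OF out mid]) auto
    moreover have "\<epsilon> * (integral {0..T} ?s - (\<Sum>i<M. c i * (\<rho> ^ m / \<rho> ^ (2 * i)) * (T ^ Suc (2 * i) / real (Suc (2 * i))))) \<le>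
        C * (\<rho> ^ m / \<rho> ^ (2 * M)) * (T ^ Suc (2 * M) / real (Suc (2 * M)))"
      using bounds[OF \<rho>] T by (intro has_integral_le[OF mid out]) auto
    moreover have "(\<Sum>i<M. c i / real (Suc (2 * i)) * (\<rho> ^ m / \<rho> ^ (2 * i)) * T ^ Suc (2 * i)) =
        (\<Sum>i<M. c i * (\<rho> ^ m / \<rho> ^ (2 * i)) * (T ^ Suc (2 * i) / real (Suc (2 * i))))"
      by (intro sum.cong refl) (simp del: of_nat_Suc power_Suc)
    ultimately show "\<delta> / real (Suc (2 * M)) * (\<rho> ^ m / \<rho> ^ (2 * M)) * T ^ Suc (2 * M) \<le>
        \<epsilon> * (integral {0..T} ?s - (\<Sum>i<M. c i / real (Suc (2 * i)) * (\<rho> ^ m / \<rho> ^ (2 * i)) * T ^ Suc (2 * i))) \<and>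
      \<epsilon> * (integral {0..T} ?s - (\<Sum>i<M. c i / real (Suc (2 * i)) * (\<rho> ^ m / \<rho> ^ (2 * i)) * T ^ Suc (2 * i))) \<le>
        C / real (Suc (2 * M)) * (\<rho> ^ m / \<rho> ^ (2 * M)) * T ^ Suc (2 * M)"
      unfolding out' by metis
  qed
qed

text \<open>The bounds r and D on \<open>\<rho>\<close> make every moment of the form
  \<open>\<rho>\<close>^(m - 2 i) finite and keep the moment of order M positive, so the averaged
  remainder still has exact order T^(2 M + 1).\<close>

lemma average_not_polynomial:
  fixes \<mu> :: "'b measure" and \<rho> :: "'b \<Rightarrow> real" and \<alpha> :: "nat \<Rightarrow> real"
  assumes fin: "finite_measure \<mu>" and pos: "measure \<mu> (space \<mu>) > 0"
    and [measurable]: "\<rho> \<in> borel_measurable \<mu>"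
    and r: "r > 0" "\<And>u. u \<in> space \<mu> \<Longrightarrow> r \<le> \<rho> u" and D: "\<And>u. u \<in> space \<mu> \<Longrightarrow> \<rho> u \<le> D"
    and m: "odd m" and b: "b > 0"
    and int: "\<And>T. 0 < T \<Longrightarrow> T \<le> r / 2 \<Longrightarrow> integrable \<mu> (\<lambda>u. integral {0..T} (\<lambda>t. sqrt ((\<rho> u)\<^sup>2 - t\<^sup>2) ^ m))"
    and eq: "\<And>T. 0 < T \<Longrightarrow> T \<le> r / 2 \<Longrightarrow>
      (\<Sum>k\<le>N. \<alpha> k * T ^ Suc k) = b * (\<integral>u. integral {0..T} (\<lambda>t. sqrt ((\<rho> u)\<^sup>2 - t\<^sup>2) ^ m) \<partial>\<mu>)"
  shows False
proof -
  interpret finite_measure \<mu> by (rule fin)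
  \<comment> \<open>M > m fixes the sign of the Taylor remainder, and 2 M >= N + 1 keeps the assumed
    polynomial, of degree at most N + 1 after integration, below the order 2 M + 1 of the
    remainder.\<close>
  define M where "M = N + m + 1"
  have "m < M" by (simp add: M_def)
  define J where "J T u = integral {0..T} (\<lambda>t. sqrt ((\<rho> u)\<^sup>2 - t\<^sup>2) ^ m)" for T u
  define W where "W i u = \<rho> u ^ m / \<rho> u ^ (2 * i)" for i u
  define w where "w i = (\<integral>u. W i u \<partial>\<mu>)" for i
  obtain \<delta> \<epsilon> c C where \<delta>: "\<delta> > 0" and bounds: "\<And>\<rho> T. 0 < \<rho> \<Longrightarrow> 0 \<le> T \<Longrightarrow> T \<le> \<rho> / 2 \<Longrightarrow>
      \<delta> * (\<rho> ^ m / \<rho> ^ (2 * M)) * T ^ Suc (2 * M) \<le>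
        \<epsilon> * (integral {0..T} (\<lambda>t. sqrt (\<rho>\<^sup>2 - t\<^sup>2) ^ m) - (\<Sum>i<M. c i * (\<rho> ^ m / \<rho> ^ (2 * i)) * T ^ Suc (2 * i))) \<and>
      \<epsilon> * (integral {0..T} (\<lambda>t. sqrt (\<rho>\<^sup>2 - t\<^sup>2) ^ m) - (\<Sum>i<M. c i * (\<rho> ^ m / \<rho> ^ (2 * i)) * T ^ Suc (2 * i))) \<le>
        C * (\<rho> ^ m / \<rho> ^ (2 * M)) * T ^ Suc (2 * M)"
    by (rule integral_sqrt_power_expansion[OF m \<open>m < M\<close>]) blast
  have bW: "r ^ m / D ^ (2 * i) \<le> W i u" "W i u \<le> D ^ m / r ^ (2 * i)" if u: "u \<in> space \<mu>" for i u
    unfolding W_def using r(1) r(2)[OF u] D[OF u] by (auto intro!: frac_le power_mono)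
  have intW: "integrable \<mu> (W i)" for i
  proof (rule integrable_const_bound)
    show "AE u in \<mu>. norm (W i u) \<le> D ^ m / r ^ (2 * i)"
    proof (rule AE_I2)
      fix u assume u: "u \<in> space \<mu>"
      have "0 \<le> W i u" unfolding W_def using r(1) r(2)[OF u] by simp
      with bW(2)[OF u, of i] show "norm (W i u) \<le> D ^ m / r ^ (2 * i)" by simp
    qed
    show "W i \<in> borel_measurable \<mu>" unfolding W_def by measurable
  qed
  have ne: "space \<mu> \<noteq> {}" using pos by auto
  then have "D > 0" using r D by (meson ex_in_conv less_le_trans order_trans)
  have wM: "w M > 0"
  proof -
    have "0 < r ^ m / D ^ (2 * M) * measure \<mu> (space \<mu>)"
      using pos r(1) \<open>D > 0\<close> by simp
    also have "\<dots> = (\<integral>u. r ^ m / D ^ (2 * M) \<partial>\<mu>)" by simp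
    also have "\<dots> \<le> w M"
      unfolding w_def by (intro integral_mono intW) (auto intro: bW)
    finally show ?thesis .
  qed
  \<comment> \<open>Up to the sign factor \<open>\<epsilon>\<close>, the assumed polynomial minus
    the averaged Taylor part. By the assumed identity it equals the averaged remainder for small T >
    0.\<close>
  define p where "p = (\<Sum>k\<le>N. monom (\<epsilon> * \<alpha> k) (Suc k)) - (\<Sum>i<M. monom (\<epsilon> * b * c i * w i) (Suc (2 * i)))"
  have poly: "poly p T = \<epsilon> * ((\<Sum>k\<le>N. \<alpha> k * T ^ Suc k) - b * (\<Sum>i<M. c i * w i * T ^ Suc (2 * i)))" for T
    unfolding p_def poly_diff poly_sum poly_monom right_diff_distrib sum_distrib_left by (simp only: mult.assoc)
  have deg: "degree p \<le> 2 * M"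
    unfolding p_def
    by (intro degree_diff_le degree_sum_le) (auto intro!: order_trans[OF degree_monom_le] simp: M_def)
  have sandwich: "b * \<delta> * w M * T ^ Suc (2 * M) \<le> poly p T \<and> poly p T \<le> b * C * w M * T ^ Suc (2 * M)"
    if T: "0 < T" "T \<le> r / 2" for T
  proof -
    let ?E = "\<lambda>u. \<epsilon> * (J T u - (\<Sum>i<M. c i * W i u * T ^ Suc (2 * i)))"
    have intJ: "integrable \<mu> (J T)" unfolding J_def by (rule int[OF T])
    have intE: "integrable \<mu> ?E"
      by (intro integrable_mult_right Bochner_Integration.integrable_diff intJ Bochner_Integration.integrable_sum integrable_mult_left intW)
    have EJ: "(\<integral>u. ?E u \<partial>\<mu>) = \<epsilon> * ((\<integral>u. J T u \<partial>\<mu>) - (\<Sum>i<M. c i * w i * T ^ Suc (2 * i)))"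
      unfolding w_def by (simp add: intJ intW del: power_Suc)
    have eqJ: "(\<Sum>k\<le>N. \<alpha> k * T ^ Suc k) = b * (\<integral>u. J T u \<partial>\<mu>)"
      using eq[OF T] by (simp only: J_def)
    have "poly p T = b * (\<integral>u. ?E u \<partial>\<mu>)"
      unfolding EJ poly eqJ by (simp only: right_diff_distrib mult.left_commute)
    moreover have *: "\<delta> * W M u * T ^ Suc (2 * M) \<le> ?E u \<and> ?E u \<le> C * W M u * T ^ Suc (2 * M)" if u: "u \<in> space \<mu>" for u
      unfolding J_def W_def using r(1) r(2)[OF u] T by (intro bounds) auto
    have "(\<integral>u. \<delta> * W M u * T ^ Suc (2 * M) \<partial>\<mu>) \<le> (\<integral>u. ?E u \<partial>\<mu>)"
      using * by (intro integral_mono intE integrable_mult_left integrable_mult_right intW) auto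
    then have "\<delta> * w M * T ^ Suc (2 * M) \<le> (\<integral>u. ?E u \<partial>\<mu>)"
      unfolding w_def by (simp add: intW del: power_Suc)
    moreover have "(\<integral>u. ?E u \<partial>\<mu>) \<le> (\<integral>u. C * W M u * T ^ Suc (2 * M) \<partial>\<mu>)"
      using * by (intro integral_mono intE integrable_mult_left integrable_mult_right intW) auto
    then have "(\<integral>u. ?E u \<partial>\<mu>) \<le> C * w M * T ^ Suc (2 * M)"
      unfolding w_def by (simp add: intW del: power_Suc)
    ultimately show ?thesis
      using b by (simp add: mult.assoc del: power_Suc)
  qed
  show False
    by (rule poly_not_between_powers[of p "Suc (2 * M)" "r / 2" "b * \<delta> * w M" "b * C * w M"])
       (use deg r(1) b \<delta> wM sandwich in \<open>auto simp del: power_Suc\<close>)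
qed

section \<open>The contradiction for a convex body\<close>

theorem theorem1:
  fixes m :: nat
  assumes "CARD('n::finite) \<ge> 2"
    and "odd m" and "1 \<le> m" and "m \<le> CARD('n) - 1"
  shows "\<nexists>K :: (real ^ 'n) set.
           convex_body K \<and> 0 \<in> interior K \<and> polynomial_dual_section_function K m"
proof
  assume "\<exists>K :: (real ^ 'n) set. convex_body K \<and> 0 \<in> interior K \<and> polynomial_dual_section_function K m"
  then obtain K :: "(real ^ 'n) set" where K: "compact K" "convex K" and int: "0 \<in> interior K"
    and poly: "polynomial_dual_section_function K m"
    by (auto simp: convex_body_def)
  from poly obtain N and a :: "nat \<Rightarrow> real ^ 'n \<Rightarrow> real"
    where cont: "\<And>k. k \<le> N \<Longrightarrow> continuous_on (sphere 0 1) (a k)"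
    and eq: "\<And>\<xi> t. \<xi> \<in> sphere 0 1 \<Longrightarrow> t \<in> {- radial_function K (- \<xi>)..radial_function K \<xi>} \<Longrightarrow>
      dual_section_function K m \<xi> t = (\<Sum>k\<le>N. a k \<xi> * t ^ k)"
    unfolding polynomial_dual_section_function_def by metis
  have m: "m > 0" using assms(3) by simp
  have dim: "DIM(real^'n) \<ge> 2" using assms(1) by simp
  obtain r where r: "r > 0" "cball 0 r \<subseteq> K"
    using int mem_interior_cball by blast
  then have 0: "0 \<in> K" by auto
  obtain D where D: "\<And>x. x \<in> K \<Longrightarrow> norm x \<le> D"
    using compact_imp_bounded[OF K(1)] by (auto simp: bounded_iff)
  obtain \<rho> where \<rho>_meas [measurable]: "\<rho> \<in> borel_measurable borel"
    and \<rho>: "\<And>w. w \<noteq> 0 \<Longrightarrow> \<rho> w = radial_function K (sgn w)"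
    using borel_measurable_radial_function_sgn[OF K 0] by metis
  obtain e :: "real^'n" where "e \<in> Basis" using nonempty_Basis by blast
  then have e: "norm e = 1" by simp
  \<comment> \<open>The constant belongs to the hyperplane orthogonal to one fixed vector
    \<open>e\<close>; by rotation invariance it serves the average over all directions.\<close>
  define \<beta> where "\<beta> = emeasure (perp_lborel e) (cball 0 1 - {0})"
  define b where "b = enn2real \<beta>"
  have "\<beta> \<noteq> 0" unfolding \<beta>_def by (rule emeasure_perp_lborel_punctured[OF e dim])
  moreover have "\<beta> \<noteq> top"
    using emeasure_mono[of "cball 0 1 - {0}" "cball 0 1" "perp_lborel e"] emeasure_perp_lborel_cball[OF e]
    by (auto simp: \<beta>_def top_unique)
  ultimately have b: "b > 0" "\<beta> = ennreal b"
    by (simp_all add: b_def enn2real_positive_iff top.not_eq_extremum zero_less_iff_neq_zero)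
  define B where "B = cball 0 1 - {0 :: real^'n}"
  define \<mu> where "\<mu> = restrict_space (lborel :: (real^'n) measure) B"
  have B [measurable]: "B \<in> sets borel" unfolding B_def by measurable
  have space: "space \<mu> = B"
    by (simp add: \<mu>_def space_restrict_space)
  have em: "emeasure \<mu> (space \<mu>) = emeasure lborel (cball (0 :: real^'n) 1)"
  proof -
    have "emeasure \<mu> (space \<mu>) = emeasure lborel B"
      unfolding space unfolding \<mu>_def by (rule emeasure_restrict_space) simp_all
    also have "\<dots> = emeasure lborel (cball (0 :: real^'n) 1)"
      unfolding B_def by (subst emeasure_Diff) (auto simp: emeasure_lborel_countable)
    finally show ?thesis .
  qed
  have fin: "finite_measure \<mu>"
    by (rule finite_measureI) (simp add: em emeasure_unit_cball)
  interpret finite_measure \<mu> by (rule fin)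
  have pos: "measure \<mu> (space \<mu>) > 0"
    using emeasure_unit_cball[where 'a="real^'n"]
    by (simp add: measure_def em enn2real_positive_iff top.not_eq_extremum zero_less_iff_neq_zero)
  have nn: "(\<integral>\<^sup>+u. f u \<partial>\<mu>) = (\<integral>\<^sup>+u. indicator B u * f u \<partial>lborel)" for f
    unfolding \<mu>_def by (subst nn_integral_restrict_space) (simp_all add: mult.commute)
  have meas_\<mu>: "f \<in> borel_measurable \<mu>" if "f \<in> borel_measurable borel" for f :: "real^'n \<Rightarrow> real"
    unfolding \<mu>_def using that by (intro measurable_restrict_space1) simp
  have unit: "u \<noteq> 0 \<and> norm (sgn u) = 1" if "u \<in> space \<mu>" for u
    using that by (simp add: space B_def norm_sgn)
  have rad: "0 \<le> a \<Longrightarrow> a \<le> \<rho> u \<longleftrightarrow> a *\<^sub>R sgn u \<in> K" "0 \<le> \<rho> u" if "u \<in> space \<mu>" for u a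
    using radial_function_translate[OF K 0, of "sgn u"] unit[OF that] \<rho>[of u] by auto
  have \<rho>r: "r \<le> \<rho> u" if u: "u \<in> space \<mu>" for u
    using rad(1)[OF u, of r] r unit[OF u] by auto
  have \<rho>D: "\<rho> u \<le> D" if u: "u \<in> space \<mu>" for u
  proof -
    have "\<rho> u *\<^sub>R sgn u \<in> K" using rad(1)[OF u rad(2)[OF u]] by simp
    then show ?thesis using D[of "\<rho> u *\<^sub>R sgn u"] unit[OF u] rad(2)[OF u] by simp
  qed
  define J where "J T u = integral {0..T} (\<lambda>t. sqrt ((\<rho> u)\<^sup>2 - t\<^sup>2) ^ m)" for T u
  have J: "(\<integral>\<^sup>+t. indicator {0..T} t * ennreal (sqrt ((\<rho> u)\<^sup>2 - t\<^sup>2) ^ m) \<partial>lborel) = ennreal (J T u)"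
      "0 \<le> J T u" "J T u \<le> D ^ m * T"
    if u: "u \<in> space \<mu>" and T: "0 < T" "T \<le> r / 2" for T u
  proof -
    let ?s = "\<lambda>t. sqrt ((\<rho> u)\<^sup>2 - t\<^sup>2) ^ m"
    have s: "0 \<le> ?s t" "?s t \<le> D ^ m" if t: "t \<in> {0..T}" for t
    proof -
      have "t \<le> \<rho> u" using t T r(1) \<rho>r[OF u] by auto
      then have "t\<^sup>2 \<le> (\<rho> u)\<^sup>2" using t by (intro power_mono) auto
      then have s0: "0 \<le> sqrt ((\<rho> u)\<^sup>2 - t\<^sup>2)" by simp
      then show "0 \<le> ?s t" by simp
      have "sqrt ((\<rho> u)\<^sup>2 - t\<^sup>2) \<le> \<rho> u"
        using rad(2)[OF u] by (intro real_le_lsqrt) auto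
      then show "?s t \<le> D ^ m" using s0 \<rho>D[OF u] by (intro power_mono) auto
    qed
    have I: "(?s has_integral J T u) {0..T}"
      unfolding J_def by (intro integrable_integral integrable_continuous_interval continuous_intros)
    show "(\<integral>\<^sup>+t. indicator {0..T} t * ennreal (?s t) \<partial>lborel) = ennreal (J T u)"
      by (rule nn_integral_indicator_has_integral[OF _ _ _ I]) (use s in auto)
    show "0 \<le> J T u"
      by (rule has_integral_nonneg[OF I]) (use s in auto)
    have "((\<lambda>t. D ^ m) has_integral D ^ m * T) {0..T}"
      using has_integral_const_real[of "D ^ m" 0 T] T by (simp add: mult.commute)
    then show "J T u \<le> D ^ m * T"
      by (rule has_integral_le[OF I]) (use s in auto)
  qed
  have intJ: "integrable \<mu> (J T)" if T: "0 < T" "T \<le> r / 2" for T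
  proof (rule integrable_const_bound)
    show "AE u in \<mu>. norm (J T u) \<le> D ^ m * T"
      using J[OF _ T] by (intro AE_I2) simp
    have "(\<lambda>u. enn2real (\<integral>\<^sup>+t. indicator {0..T} t * ennreal (sqrt ((\<rho> u)\<^sup>2 - t\<^sup>2) ^ m) \<partial>lborel)) \<in> borel_measurable \<mu>"
      by (intro meas_\<mu>) measurable
    also have "?this \<longleftrightarrow> J T \<in> borel_measurable \<mu>"
      by (rule measurable_cong) (simp add: J[OF _ T])
    finally show "J T \<in> borel_measurable \<mu>" .
  qed
  have inta: "integrable \<mu> (\<lambda>u. a k (sgn u))" if k: "k \<le> N" for k
  proof -
    \<comment> \<open>Continuity on the compact sphere bounds the coefficient, and on a finite
      measure a bounded measurable function is integrable.\<close>
    have "bounded (a k ` sphere 0 1)"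
      by (intro compact_imp_bounded compact_continuous_image cont[OF k] compact_sphere)
    then obtain C where "\<forall>x\<in>sphere 0 1. norm (a k x) \<le> C"
      unfolding bounded_iff by blast
    then have C: "norm (a k x) \<le> C" if "norm x = 1" for x
      using that by simp
    show ?thesis
    proof (rule integrable_const_bound)
      show "AE u in \<mu>. norm (a k (sgn u)) \<le> C"
        using C unit by (intro AE_I2) auto
      have "continuous_on B (\<lambda>u. a k (sgn u))"
        by (rule continuous_on_compose2[OF cont[OF k]])
          (auto simp: B_def norm_sgn split: if_splits intro!: continuous_intros)
      then have "(\<lambda>u. a k (sgn u)) \<in> borel_measurable (restrict_space borel B)"
        by (rule borel_measurable_continuous_on_restrict)
      then show "(\<lambda>u. a k (sgn u)) \<in> borel_measurable \<mu>"
        unfolding \<mu>_def by (simp cong: measurable_cong_sets sets_restrict_space_cong)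
    qed
  qed
  \<comment> \<open>The divisor k + 1 comes from integrating t^k over {0..T}.\<close>
  define \<alpha> where "\<alpha> k = (\<integral>u. a k (sgn u) \<partial>\<mu>) / real (Suc k)" for k
  \<comment> \<open>The restriction T <= r / 2 keeps the ball of radius T inside \<open>K\<close>
    and, since every \<open>\<rho> u\<close> is at least r, also meets the condition T <=
    \<open>\<rho> u\<close> / 2 of the expansion.\<close>
  have avg: "(\<Sum>k\<le>N. \<alpha> k * T ^ Suc k) = b * (\<integral>u. J T u \<partial>\<mu>)" if T: "0 < T" "T \<le> r / 2" for T
  proof -
    let ?q = "\<lambda>u. \<Sum>k\<le>N. a k (sgn u) * (T ^ Suc k / real (Suc k))"
    have q: "(\<integral>\<^sup>+t. indicator {0..T} t * ennreal (dual_section_function K m (sgn u) t) \<partial>lborel) = ennreal (?q u)"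
        "0 \<le> ?q u" if u: "u \<in> space \<mu>" for u
    proof -
      note n = conjunct2[OF unit[OF u]]
      let ?p = "\<lambda>t. \<Sum>k\<le>N. a k (sgn u) * t ^ k"
      have p: "dual_section_function K m (sgn u) t = ?p t" "0 \<le> ?p t" if t: "t \<in> {0..T}" for t
      proof -
        have "t \<le> \<rho> u" using t T r(1) \<rho>r[OF u] by auto
        moreover have "0 \<le> radial_function K (- sgn u)"
          using radial_function_translate(1)[OF K 0, of "- sgn u"] n by simp
        ultimately have "t \<in> {- radial_function K (- sgn u)..radial_function K (sgn u)}"
          using t \<rho>[of u] unit[OF u] by auto
        with n show p: "dual_section_function K m (sgn u) t = ?p t"
          by (intro eq) auto
        \<comment> \<open>The polynomial inherits nonnegativity on {0..T} from the dual volume,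
          which permits the passage between real and \<open>ennreal\<close> integrals.\<close>
        have "t *\<^sub>R sgn u \<in> K"
          using rad(1)[OF u, of t] t \<open>t \<le> \<rho> u\<close> by simp
        from dual_section_function_eq(2)[OF dim m n K this] show "0 \<le> ?p t"
          by (simp only: p)
      qed
      have I: "(?p has_integral ?q u) {0..T}"
        using T by (intro has_integral_sum has_integral_mult_right has_integral_power) auto
      have "(\<integral>\<^sup>+t. indicator {0..T} t * ennreal (dual_section_function K m (sgn u) t) \<partial>lborel) =
          (\<integral>\<^sup>+t. indicator {0..T} t * ennreal (?p t) \<partial>lborel)"
        using p by (intro nn_integral_cong) (simp add: indicator_def)
      also have "\<dots> = ennreal (?q u)"
        by (rule nn_integral_indicator_has_integral[OF _ _ _ I]) (use p in auto)
      finally show "(\<integral>\<^sup>+t. indicator {0..T} t * ennreal (dual_section_function K m (sgn u) t) \<partial>lborel) = ennreal (?q u)" .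
      show "0 \<le> ?q u"
        by (rule has_integral_nonneg[OF I]) (use p in auto)
    qed
    have intq: "integrable \<mu> ?q"
      by (intro Bochner_Integration.integrable_sum integrable_mult_left inta) auto
    have cT: "cball 0 T \<subseteq> K" "0 \<le> T" using T r by (auto intro: subset_trans[OF subset_cball])
    have "ennreal (\<integral>u. ?q u \<partial>\<mu>) = (\<integral>\<^sup>+u. ennreal (?q u) \<partial>\<mu>)"
      using q(2) by (intro nn_integral_eq_integral[symmetric] intq AE_I2)
    also have "\<dots> = (\<integral>\<^sup>+u. (\<integral>\<^sup>+t. indicator {0..T} t * ennreal (dual_section_function K m (sgn u) t) \<partial>lborel) \<partial>\<mu>)"
      by (intro nn_integral_cong) (simp add: q(1))
    also have "\<dots> = (\<integral>\<^sup>+u. \<beta> * (\<integral>\<^sup>+t. indicator {0..T} t * ennreal (sqrt ((radial_function K (sgn u))\<^sup>2 - t\<^sup>2) ^ m) \<partial>lborel) \<partial>\<mu>)"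
      unfolding nn B_def \<beta>_def by (rule nn_integral_dual_section_average[OF assms(1) m e K cT(2,1)])
    also have "\<dots> = (\<integral>\<^sup>+u. ennreal (b * J T u) \<partial>\<mu>)"
    proof (rule nn_integral_cong)
      fix u assume u: "u \<in> space \<mu>"
      have "radial_function K (sgn u) = \<rho> u" using \<rho> unit[OF u] by simp
      then show "\<beta> * (\<integral>\<^sup>+t. indicator {0..T} t * ennreal (sqrt ((radial_function K (sgn u))\<^sup>2 - t\<^sup>2) ^ m) \<partial>lborel) = ennreal (b * J T u)"
        using J(1)[OF u T] J(2)[OF u T] b by (simp add: ennreal_mult)
    qed
    also have "\<dots> = ennreal (\<integral>u. b * J T u \<partial>\<mu>)"
      using J(2)[OF _ T] b by (intro nn_integral_eq_integral integrable_mult_right intJ[OF T] AE_I2) auto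
    finally have "(\<integral>u. ?q u \<partial>\<mu>) = (\<integral>u. b * J T u \<partial>\<mu>)"
      using q(2) J(2)[OF _ T] b by (subst (asm) ennreal_inj) (auto intro!: Bochner_Integration.integral_nonneg)
    moreover have "(\<integral>u. ?q u \<partial>\<mu>) = (\<Sum>k\<le>N. \<alpha> k * T ^ Suc k)"
      unfolding \<alpha>_def using inta by (simp del: power_Suc of_nat_Suc)
    ultimately show ?thesis by simp
  qed
  show False
    by (rule average_not_polynomial[OF fin pos meas_\<mu>[OF \<rho>_meas] r(1) \<rho>r \<rho>D assms(2) b(1), where N=N and \<alpha>=\<alpha>])
      (use intJ avg in \<open>simp_all add: J_def[abs_def]\<close>)
qed

end
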